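(* Every uniform algebra is $\mathbb{C}$-lush. The uniform closure $\overline{\operatorname{Re}A}$ of the real part $\operatorname{Re}A=\{\operatorname{Re}f:f\in A\}$ of a uniform algebra $A$ is $\mathbb{R}$-lush. Hence the uniform closure of the real part of a uniform algebra has the Mazur-Ulam property.
   Context: A uniform algebra on a compact Hausdorff space $X$ is a closed subalgebra of $C(X,\mathbb{C})$ (complex continuous functions with the supremum norm) which contains the constants and separates the points of $X$. Let $B$ be a Banach space over $\mathbb{K}=\mathbb{R}$ or $\mathbb{C}$, $S(B)$ its unit sphere, $\operatorname{Ball}(B)$ its closed unit ball, $B^*$ its dual. For $p\in S(B^* )$ and $\delta>0$ the slice is $SL(\operatorname{Ball}(B),p,\delta)=\{a\in\operatorname{Ball}(B):\operatorname{Re}p(a)>1-\delta\}$. $B$ is $\mathbb{K}$-lush if for every $a,b\in S(B)$ and every $\varepsilon>0$ there exists $q\in S(B^* )$ such that $b\in SL(\operatorname{Ball}(B),q,\varepsilon)$ and $d(a,\operatorname{co}(\mathbb{T}\,SL(\operatorname{Ball}(B),q,\varepsilon)))<\varepsilon$, where $\mathbb{T}=\{z\in\mathbb{K}:|z|=1\}$, $\operatorname{co}$ denotes the convex hull and $d$ is the distance from a point to a set. A real Banach space $B$ has the Mazur-Ulam property if for any real Banach space $B'$, every surjective isometry from $S(B)$ onto $S(B')$ admits an extension to a surjective real-linear isometry from $B$ onto $B'$. *)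

theory Defs
  imports "HOL-Analysis.Analysis"
begin

section \<open>Banach spaces over the real or complex field\<close>

text \<open>
  Banach spaces are complete linear subspaces \<open>B\<close> of an ambient normed space, so that uniform
  algebras, which are not types, are covered. The scalar field is the type \<open>'k\<close>, to be
  instantiated with \<^typ>\<open>real\<close> or \<^typ>\<open>complex\<close>; its multiplication \<open>smul\<close> on vectors has to
  extend the real one of the ambient type, on which \<^const>\<open>convex\<close> is based.
\<close>

locale normed_space_over = vector_space smul
  for smul :: "'k::{real_normed_field, real_inner} \<Rightarrow> 'v::real_normed_vector \<Rightarrow> 'v" +
  assumes smul_of_real: "smul (of_real r) x = r *\<^sub>R x"
    and norm_smul: "norm (smul c x) = norm c * norm x"

definition banach_over ::
    "('k::{real_normed_field, real_inner} \<Rightarrow> 'v::real_normed_vector \<Rightarrow> 'v) \<Rightarrow> 'v set \<Rightarrow> bool"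
  where "banach_over smul B \<longleftrightarrow>
    normed_space_over smul \<and> module.subspace smul B \<and> complete B"

definition unit_sphere :: "'v::real_normed_vector set \<Rightarrow> 'v set"
  where "unit_sphere B = {x \<in> B. norm x = 1}"

definition unit_ball :: "'v::real_normed_vector set \<Rightarrow> 'v set"
  where "unit_ball B = {x \<in> B. norm x \<le> 1}"

definition linear_map_on ::
    "('k \<Rightarrow> 'v \<Rightarrow> 'v) \<Rightarrow> ('k \<Rightarrow> 'w \<Rightarrow> 'w) \<Rightarrow> 'v::ab_group_add set \<Rightarrow> ('v \<Rightarrow> 'w::ab_group_add) \<Rightarrow> bool"
  where "linear_map_on s1 s2 B f \<longleftrightarrow>
    (\<forall>x\<in>B. \<forall>y\<in>B. f (x + y) = f x + f y) \<and> (\<forall>c. \<forall>x\<in>B. f (s1 c x) = s2 c (f x))"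

text \<open>
  The values of a functional outside \<open>B\<close> are irrelevant. Boundedness is required separately,
  since the supremum defining the dual norm is meaningless without it.
\<close>

definition dual_space ::
    "('k::{real_normed_field, real_inner} \<Rightarrow> 'v::real_normed_vector \<Rightarrow> 'v) \<Rightarrow> 'v set
      \<Rightarrow> ('v \<Rightarrow> 'k) set"
  where "dual_space smul B =
    {p. linear_map_on smul (*) B p \<and> bounded (p ` unit_ball B)}"

definition dual_norm ::
    "'v::real_normed_vector set \<Rightarrow> ('v \<Rightarrow> 'k::real_normed_vector) \<Rightarrow> real"
  where "dual_norm B p = (SUP x\<in>unit_ball B. norm (p x))"

definition dual_sphere ::
    "('k::{real_normed_field, real_inner} \<Rightarrow> 'v::real_normed_vector \<Rightarrow> 'v) \<Rightarrow> 'v set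
      \<Rightarrow> ('v \<Rightarrow> 'k) set"
  where "dual_sphere smul B = {p \<in> dual_space smul B. dual_norm B p = 1}"


section \<open>Lushness\<close>

text \<open>For both scalar fields, \<open>z \<bullet> 1\<close> is the real part of \<open>z\<close>.\<close>

lemma inner_one_complex: "z \<bullet> 1 = Re z" for z :: complex
  by (simp add: inner_complex_def)

lemma inner_one_real: "z \<bullet> 1 = z" for z :: real
  by simp

definition slice ::
    "'v::real_normed_vector set \<Rightarrow> ('v \<Rightarrow> 'k::{real_normed_field, real_inner}) \<Rightarrow> real \<Rightarrow> 'v set"
  where "slice B p \<delta> = {a \<in> unit_ball B. p a \<bullet> 1 > 1 - \<delta>}"

definition torus_mult ::
    "('k::{real_normed_field, real_inner} \<Rightarrow> 'v \<Rightarrow> 'v) \<Rightarrow> 'v set \<Rightarrow> 'v set"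
  where "torus_mult smul S = {smul z x | z x. norm z = 1 \<and> x \<in> S}"

text \<open>
  The hull below is never empty, as it contains \<open>b\<close>; so \<^const>\<open>infdist\<close>, which is \<open>0\<close> for the
  empty set, is the usual distance.
\<close>

definition lush ::
    "('k::{real_normed_field, real_inner} \<Rightarrow> 'v::real_normed_vector \<Rightarrow> 'v) \<Rightarrow> 'v set \<Rightarrow> bool"
  where "lush smul B \<longleftrightarrow> banach_over smul B \<and>
    (\<forall>a\<in>unit_sphere B. \<forall>b\<in>unit_sphere B. \<forall>\<epsilon>>0. \<exists>q\<in>dual_sphere smul B.
       b \<in> slice B q \<epsilon> \<and>
       infdist a (convex hull (torus_mult smul (slice B q \<epsilon>))) < \<epsilon>)"


section \<open>The Mazur--Ulam property\<close>

definition surj_isometry ::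
    "'v::metric_space set \<Rightarrow> 'w::metric_space set \<Rightarrow> ('v \<Rightarrow> 'w) \<Rightarrow> bool"
  where "surj_isometry S T f \<longleftrightarrow> f ` S = T \<and> (\<forall>x\<in>S. \<forall>y\<in>S. dist (f x) (f y) = dist x y)"

text \<open>
  A definition cannot quantify over types, so the target space is the parameter \<open>'w\<close>. The
  Mazur--Ulam property of \<open>B\<close> is the assertion for all \<open>'w\<close>, i.e. with \<open>'w\<close> a type variable
  of a theorem.
\<close>

definition mazur_ulam_property ::
    "'w::banach itself \<Rightarrow> 'v::real_normed_vector set \<Rightarrow> bool"
  where "mazur_ulam_property _ B \<longleftrightarrow> banach_over scaleR B \<and>
    (\<forall>f :: 'v \<Rightarrow> 'w. surj_isometry (unit_sphere B) (unit_sphere UNIV) f \<longrightarrow>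
       (\<exists>g. linear_map_on scaleR scaleR B g \<and> surj_isometry B UNIV g \<and>
            (\<forall>x\<in>unit_sphere B. g x = f x)))"


section \<open>Uniform algebras\<close>

text \<open>
  On a compact space every continuous function is bounded, so that \<open>'x \<Rightarrow>\<^sub>C complex\<close> with its
  norm is the algebra of all continuous functions with the supremum norm. The library provides
  neither its multiplication nor its complex scaling.
\<close>

context
  includes bcontfun.lifting
begin

lift_definition times_bcontfun ::
    "('x::topological_space \<Rightarrow>\<^sub>C complex) \<Rightarrow> ('x \<Rightarrow>\<^sub>C complex) \<Rightarrow> 'x \<Rightarrow>\<^sub>C complex"
  is "\<lambda>f g x. f x * g x"
proof -
  fix f g :: "'x \<Rightarrow> complex"
  assume f: "f \<in> bcontfun" and g: "g \<in> bcontfun"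
  obtain a b where "\<And>x. norm (f x) \<le> a" "\<And>x. norm (g x) \<le> b"
    using f g by (auto simp: bcontfun_def bounded_iff)
  then have "norm (f x * g x) \<le> a * b" for x
    by (metis norm_mult mult_mono' norm_ge_zero)
  then have "bounded (range (\<lambda>x. f x * g x))"
    by (auto simp: bounded_iff)
  then show "(\<lambda>x. f x * g x) \<in> bcontfun"
    using f g by (auto simp: bcontfun_def intro!: continuous_intros)
qed

lift_definition Re_bcontfun ::
    "('x::topological_space \<Rightarrow>\<^sub>C complex) \<Rightarrow> 'x \<Rightarrow>\<^sub>C real"
  is "\<lambda>f x. Re (f x)"
proof -
  fix f :: "'x \<Rightarrow> complex"
  assume f: "f \<in> bcontfun"
  then have "bounded (Re ` range f)"
    by (intro bounded_linear_image bounded_linear_Re) (simp add: bcontfun_def)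
  then show "(\<lambda>x. Re (f x)) \<in> bcontfun"
    using f by (auto simp: bcontfun_def image_image intro!: continuous_intros)
qed

end

definition scaleC_bcontfun ::
    "complex \<Rightarrow> ('x::topological_space \<Rightarrow>\<^sub>C complex) \<Rightarrow> 'x \<Rightarrow>\<^sub>C complex"
  where "scaleC_bcontfun c f = times_bcontfun (const_bcontfun c) f"

definition uniform_algebra :: "('x::t2_space \<Rightarrow>\<^sub>C complex) set \<Rightarrow> bool"
  where "uniform_algebra A \<longleftrightarrow>
    compact (UNIV :: 'x set) \<and>
    module.subspace scaleC_bcontfun A \<and>
    (\<forall>f\<in>A. \<forall>g\<in>A. times_bcontfun f g \<in> A) \<and>
    closed A \<and>
    range const_bcontfun \<subseteq> A \<and>
    (\<forall>x y. x \<noteq> y \<longrightarrow> (\<exists>f\<in>A. apply_bcontfun f x \<noteq> apply_bcontfun f y))"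

lemma normed_space_over_scaleR:
  "normed_space_over (scaleR :: real \<Rightarrow> 'v::real_normed_vector \<Rightarrow> 'v)"
  by unfold_locales (simp_all add: algebra_simps)

lemma normed_space_over_scaleC:
  "normed_space_over (scaleC_bcontfun :: complex \<Rightarrow> ('x::topological_space \<Rightarrow>\<^sub>C complex) \<Rightarrow> _)"
proof
  fix c d :: complex and r :: real and f g :: "'x \<Rightarrow>\<^sub>C complex"
  note rep = scaleC_bcontfun_def times_bcontfun.rep_eq const_bcontfun.rep_eq plus_bcontfun.rep_eq
    scaleR_bcontfun.rep_eq
  show "scaleC_bcontfun c (f + g) = scaleC_bcontfun c f + scaleC_bcontfun c g"
    by (rule bcontfun_eqI) (simp add: rep algebra_simps)
  show "scaleC_bcontfun (c + d) f = scaleC_bcontfun c f + scaleC_bcontfun d f"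
    by (rule bcontfun_eqI) (simp add: rep algebra_simps)
  show "scaleC_bcontfun c (scaleC_bcontfun d f) = scaleC_bcontfun (c * d) f"
    by (rule bcontfun_eqI) (simp add: rep algebra_simps)
  show "scaleC_bcontfun 1 f = f"
    by (rule bcontfun_eqI) (simp add: rep)
  show "scaleC_bcontfun (of_real r) f = r *\<^sub>R f"
    by (rule bcontfun_eqI) (simp add: rep scaleR_conv_of_real)
  have le: "norm (scaleC_bcontfun c h) \<le> norm c * norm h" for c and h :: "'x \<Rightarrow>\<^sub>C complex"
    by (rule norm_bound) (simp add: rep norm_mult mult_left_mono norm_bounded)
  show "norm (scaleC_bcontfun c f) = norm c * norm f"
  proof (cases "c = 0")
    case True
    then show ?thesis using le[of c f] by simp
  next
    case False
    have "scaleC_bcontfun (inverse c) (scaleC_bcontfun c f) = f"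
      by (rule bcontfun_eqI) (use False in \<open>simp add: rep\<close>)
    then have "norm f \<le> inverse (norm c) * norm (scaleC_bcontfun c f)"
      using le[of "inverse c" "scaleC_bcontfun c f"] by (simp add: norm_inverse)
    then have "norm c * norm f \<le> norm (scaleC_bcontfun c f)"
      using False by (simp add: field_simps)
    then show ?thesis using le[of c f] by simp
  qed
qed

end

theory Submission
  imports Defs "HOL-Complex_Analysis.Cauchy_Integral_Formula"
begin

text \<open>
  The point evaluations are the functionals behind all three assertions. The space \<open>X\<close> is compact, and
  a bump function at \<open>x\<close> is an element of the algebra that is \<open>1\<close> at \<open>x\<close>, has values near \<open>[0,1]\<close>,
  and is small outside a neighbourhood of \<open>x\<close> in which finitely many given functions are almost constant.
  With it, the value \<open>a x\<close> of a function \<open>a\<close> of norm at most \<open>1\<close> can be changed to any number of the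
  unit disc, essentially without leaving the unit ball and without changing \<open>a\<close> elsewhere. Moving \<open>a x\<close> to
  two unimodular numbers with mean \<open>a x\<close> shows that \<open>a\<close> is nearly a convex combination of
  unimodular multiples of elements of the slice given by evaluation at \<open>x\<close>. This is lushness, provided
  that \<open>x\<close> can be chosen such that a prescribed function \<open>b\<close> nearly attains its norm at \<open>x\<close>.

  Bump functions do not exist at every point, but the point may depend on the finitely many functions involved.
  Map \<open>X\<close> by these functions into a Hermitian space and take for \<open>x\<close> a point whose image is farthest from
  a remote centre. The tangent plane there gives a function \<open>f\<close> of the algebra with
  \<open>norm f \<le> 1\<close> and \<open>f x = 1\<close> such that all given functions \<open>F\<close> satisfy
  \<open>norm (F y - F x) ^ 2 \<le> K (1 - Re (f y))\<close> (\<open>peak_near_maximum\<close>); the position of the centre makes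
  \<open>b\<close> almost maximal at \<open>x\<close>. The bump is \<open>1 - w\<close>, where \<open>w\<close> is a small fractional power of
  \<open>(1 - f) / 2\<close> (\<open>sector_peaking_function\<close>). For real parts the estimates are sharp enough to
  move the value at \<open>x\<close> to \<open>1\<close> or \<open>- 1\<close> within the unit ball (\<open>ReA_near_faces\<close>), so the distances of
  \<open>a\<close> from the faces \<open>{h. h x = 1}\<close> and \<open>{h. h x = - 1}\<close> of the unit sphere are \<open>1 - a x\<close> and \<open>1 + a x\<close>, up
  to an arbitrarily small error.

  For the Mazur--Ulam property, let \<open>T\<close> be an isometry from the unit sphere onto another one. It maps the
  two opposite faces at \<open>x\<close> into the sets where some functional \<open>\<phi> x\<close> of norm at most one is \<open>1\<close> and
  \<open>- 1\<close>, respectively (\<open>convex_face_functional\<close>). As \<open>T\<close> preserves distances from the faces,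
  \<open>\<phi> x (T a)\<close> is \<open>a x\<close> up to a small error. The functionals thus carry the linear structure of the function
  space over to the target, and the positively homogeneous extension of \<open>T\<close> is a linear isometry
  (\<open>linear_isometry_if_jointly_normed\<close>).
\<close>

section \<open>Sublinear functionals and the Hahn--Banach theorem\<close>

definition sublinear :: "('v::real_vector \<Rightarrow> real) \<Rightarrow> bool"
  where "sublinear p \<longleftrightarrow> (\<forall>x y. p (x + y) \<le> p x + p y) \<and> (\<forall>t>0. \<forall>x. p (t *\<^sub>R x) = t * p x)"

lemma sublinearI:
  assumes "\<And>x y. p (x + y) \<le> p x + p y" "\<And>t x. t > 0 \<Longrightarrow> p (t *\<^sub>R x) \<le> t * p x"
  shows "sublinear p"
  unfolding sublinear_def
proof (intro conjI allI impI)
  fix t :: real and x assume t: "t > 0"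
  have "p x \<le> inverse t * p (t *\<^sub>R x)"
    using assms(2)[of "inverse t" "t *\<^sub>R x"] t by simp
  then have "t * p x \<le> p (t *\<^sub>R x)"
    using t by (simp add: field_simps)
  then show "p (t *\<^sub>R x) = t * p x"
    using assms(2)[OF t, of x] by simp
qed (rule assms(1))

lemma sublinear_add: "sublinear p \<Longrightarrow> p (x + y) \<le> p x + p y"
  and sublinear_scale: "sublinear p \<Longrightarrow> t > 0 \<Longrightarrow> p (t *\<^sub>R x) = t * p x"
  by (auto simp: sublinear_def)

lemma sublinear_zero:
  assumes "sublinear p"
  shows "p 0 = 0"
  using sublinear_scale[OF assms, of 2 0] by simp

lemma sublinear_minus:
  assumes "sublinear p"
  shows "- p (- x) \<le> p x"
  using sublinear_add[OF assms, of x "- x"] sublinear_zero[OF assms] by simp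

text \<open>
  The function \<open>q\<close> is \<open>y \<mapsto> inf {p (y + t c) - t m | t \<ge> 0, c \<in> C}\<close>. It is subadditive because \<open>C\<close> is
  convex, so that \<open>t c + t' c'\<close> is again \<open>t + t'\<close> times an element of \<open>C\<close>; the infimum is finite
  because \<open>p (y + t c) \<ge> p (t c) - p (- y) \<ge> t m - p (- y)\<close>. The lemma serves twice: with a singleton
  \<open>C\<close> it shows that minimal sublinear functionals are linear, and with a convex set on which the
  norm is at least \<open>1\<close> it yields a functional separating that set from the unit ball.
\<close>

lemma sublinear_shift:
  assumes p: "sublinear p" and C: "convex C" "C \<noteq> {}" and m: "\<And>c. c \<in> C \<Longrightarrow> m \<le> p c"
  shows "\<exists>q. sublinear q \<and> (\<forall>y. q y \<le> p y) \<and> (\<forall>c\<in>C. q (- c) \<le> - m)"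
proof -
  define I :: "(real \<times> 'a) set" where "I = {0..} \<times> C"
  define g where "g = (\<lambda>y (t, c). p (y + t *\<^sub>R c) - t * m)"
  define q where "q y = (INF i\<in>I. g y i)" for y
  have I: "I \<noteq> {}"
    using C by (auto simp: I_def)
  have lower: "- p (- y) \<le> g y i" if iI: "i \<in> I" for y i
  proof -
    obtain t c where i: "i = (t, c)" "t \<ge> 0" "c \<in> C"
      using iI by (auto simp: I_def)
    have "t * m \<le> p (t *\<^sub>R c)"
      using m[OF i(3)] i(2) sublinear_scale[OF p, of t c] sublinear_zero[OF p]
      by (cases "t = 0") (auto intro: mult_left_mono)
    also have "\<dots> \<le> p (y + t *\<^sub>R c) + p (- y)"
      using sublinear_add[OF p, of "y + t *\<^sub>R c" "- y"] by simp
    finally show ?thesis by (simp add: g_def i)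
  qed
  have le: "q y \<le> g y i" if "i \<in> I" for y i
    unfolding q_def by (rule cINF_lower[OF bdd_belowI2[OF lower] that])
  have ge: "b \<le> q y" if "\<And>i. i \<in> I \<Longrightarrow> b \<le> g y i" for y b
    unfolding q_def by (rule cINF_greatest[OF I that])
  have add: "q (y + z) \<le> g y i + g z j" if ij: "i \<in> I" "j \<in> I" for y z i j
  proof -
    obtain t c t' c' where i: "i = (t, c)" "t \<ge> 0" "c \<in> C" and j: "j = (t', c')" "t' \<ge> 0" "c' \<in> C"
      using ij by (auto simp: I_def)
    have "\<exists>d\<in>C. t *\<^sub>R c + t' *\<^sub>R c' = (t + t') *\<^sub>R d"
    proof (cases "t + t' = 0")
      case True
      then have "t = 0" "t' = 0" using i j by auto
      then show ?thesis using i by auto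
    next
      case False
      then have "(t / (t + t')) *\<^sub>R c + (t' / (t + t')) *\<^sub>R c' \<in> C"
        using C(1) i j by (intro convexD) (auto simp: add_divide_distrib[symmetric])
      then show ?thesis
        by (rule rev_bexI) (use False in \<open>simp add: scaleR_add_right\<close>)
    qed
    then obtain d where d: "d \<in> C" "t *\<^sub>R c + t' *\<^sub>R c' = (t + t') *\<^sub>R d" by auto
    have "q (y + z) \<le> g (y + z) (t + t', d)"
      by (rule le) (use d i j in \<open>auto simp: I_def\<close>)
    also have "\<dots> = p ((y + t *\<^sub>R c) + (z + t' *\<^sub>R c')) - (t + t') * m"
      using d(2) by (simp add: g_def add.assoc add.left_commute)
    also have "\<dots> \<le> g y i + g z j"
      using sublinear_add[OF p, of "y + t *\<^sub>R c" "z + t' *\<^sub>R c'"]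
      by (simp add: g_def i j algebra_simps)
    finally show ?thesis .
  qed
  have "sublinear q"
  proof (rule sublinearI)
    fix x y
    have "q (x + y) - g y j \<le> q x" if "j \<in> I" for j
      by (rule ge) (use add[OF _ that] in \<open>simp add: algebra_simps\<close>)
    then have "q (x + y) - q x \<le> q y"
      by (intro ge) (simp add: algebra_simps)
    then show "q (x + y) \<le> q x + q y" by simp
  next
    fix t :: real and x assume t: "t > 0"
    have "q (t *\<^sub>R x) / t \<le> g x i" if iI: "i \<in> I" for i
    proof -
      obtain s c where i: "i = (s, c)" "s \<ge> 0" "c \<in> C"
        using iI by (auto simp: I_def)
      have "q (t *\<^sub>R x) \<le> g (t *\<^sub>R x) (t * s, c)"
        by (rule le) (use i t in \<open>auto simp: I_def\<close>)
      also have "\<dots> = t * g x i"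
        using sublinear_scale[OF p t, of "x + s *\<^sub>R c"] by (simp add: g_def i algebra_simps)
      finally show ?thesis using t by (simp add: field_simps)
    qed
    then have "q (t *\<^sub>R x) / t \<le> q x" by (rule ge)
    then show "q (t *\<^sub>R x) \<le> t * q x" using t by (simp add: field_simps)
  qed
  moreover have "q y \<le> p y" for y
  proof -
    obtain c where "c \<in> C" using C by auto
    then show ?thesis using le[of "(0, c)" y] by (simp add: I_def g_def)
  qed
  moreover have "q (- c) \<le> - m" if "c \<in> C" for c
    using le[of "(1, c)" "- c"] that sublinear_zero[OF p] by (simp add: I_def g_def)
  ultimately show ?thesis by blast
qed

text \<open>
  Hahn--Banach. By Zorn's lemma there is a minimal sublinear functional \<open>q\<close> below \<open>p\<close>. Shifting \<open>q\<close>
  along a single vector \<open>z\<close> gives a sublinear functional below \<open>q\<close> whose value at \<open>- z\<close> is at most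
  \<open>- q z\<close>; by minimality it is \<open>q\<close> itself. So \<open>q\<close> is odd, and an odd sublinear functional is linear.
\<close>

lemma linear_below_sublinear:
  assumes p: "sublinear p"
  shows "\<exists>f. linear f \<and> (\<forall>x. f x \<le> p x)"
proof -
  define Q where "Q = {q. sublinear q \<and> q \<le> p}"
  have "\<exists>q\<in>Q. \<forall>r\<in>Q. r \<le> q \<longrightarrow> r = q"
  proof (rule predicate_Zorn[where P = "\<lambda>f g. g \<le> f"])
    show "partial_order_on Q (relation_of (\<lambda>f g. g \<le> f) Q)"
      by (rule partial_order_on_relation_ofI) auto
  next
    fix C assume "C \<in> Chains (relation_of (\<lambda>f g. g \<le> f) Q)"
    then have CQ: "C \<subseteq> Q" and chain: "\<And>f g. f \<in> C \<Longrightarrow> g \<in> C \<Longrightarrow> f \<le> g \<or> g \<le> f"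
      by (auto simp: Chains_def relation_of_def)
    show "\<exists>u\<in>Q. \<forall>a\<in>C. u \<le> a"
    proof (cases "C = {}")
      case True
      then show ?thesis using p by (auto simp: Q_def)
    next
      case ne: False
      have sub: "sublinear f" and fp: "f x \<le> p x" if "f \<in> C" for f x
        using that CQ by (auto simp: Q_def le_fun_def)
      define u where "u x = (INF f\<in>C. f x)" for x
      have "- p (- x) \<le> f x" if "f \<in> C" for f x
        using sublinear_minus[OF sub[OF that], of x] fp[OF that, of "- x"] by simp
      then have le: "u x \<le> f x" if "f \<in> C" for f x
        unfolding u_def by (intro cINF_lower[OF _ that]) (auto simp: bdd_below_def)
      have ge: "b \<le> u x" if "\<And>f. f \<in> C \<Longrightarrow> b \<le> f x" for b x
        unfolding u_def by (rule cINF_greatest[OF ne that])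
      have "sublinear u"
      proof (rule sublinearI)
        fix x y
        have "u (x + y) \<le> f x + g y" if fg: "f \<in> C" "g \<in> C" for f g
        proof -
          obtain h where h: "h \<in> C" "h \<le> f" "h \<le> g"
            using chain[OF fg] fg by auto
          have "u (x + y) \<le> h x + h y"
            using le[OF h(1)] sublinear_add[OF sub[OF h(1)]] by (rule order_trans)
          also have "\<dots> \<le> f x + g y"
            using h(2,3) by (auto simp: le_fun_def intro: add_mono)
          finally show ?thesis .
        qed
        then have "u (x + y) - g y \<le> u x" if "g \<in> C" for g
          by (intro ge) (use that in \<open>simp add: algebra_simps\<close>)
        then have "u (x + y) - u x \<le> u y"
          by (intro ge) (simp add: algebra_simps)
        then show "u (x + y) \<le> u x + u y" by simp
      next
        fix t :: real and x assume t: "t > 0"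
        have "u (t *\<^sub>R x) / t \<le> f x" if "f \<in> C" for f
          using le[OF that, of "t *\<^sub>R x"] sublinear_scale[OF sub[OF that] t, of x] t
          by (simp add: field_simps)
        then have "u (t *\<^sub>R x) / t \<le> u x" by (rule ge)
        then show "u (t *\<^sub>R x) \<le> t * u x" using t by (simp add: field_simps)
      qed
      moreover have "u \<le> p"
        using ne le fp by (fastforce simp: le_fun_def intro: order_trans)
      ultimately show ?thesis
        using le by (intro bexI[of _ u]) (auto simp: Q_def le_fun_def)
    qed
  qed
  then obtain q where q: "sublinear q" "q \<le> p" and
    min: "\<And>r. sublinear r \<Longrightarrow> r \<le> q \<Longrightarrow> r = q"
    by (auto simp: Q_def intro: order_trans)
  have neg: "q (- z) = - q z" for z
  proof -
    obtain r where r: "sublinear r" "\<And>y. r y \<le> q y" "r (- z) \<le> - q z"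
      using sublinear_shift[OF q(1), of "{z}" "q z"] by auto
    have "r = q" by (rule min) (use r in \<open>auto simp: le_fun_def\<close>)
    then show ?thesis
      using r(3) sublinear_minus[OF q(1), of z] by simp
  qed
  have add: "q (x + y) = q x + q y" for x y
    using sublinear_add[OF q(1), of x y] sublinear_add[OF q(1), of "- x" "- y"] neg[of x] neg[of y]
      neg[of "x + y"] by simp
  have "linear q"
  proof (rule linearI)
    fix c :: real and x
    consider "c = 0" | "c > 0" | "- c > 0" by linarith
    then show "q (c *\<^sub>R x) = c *\<^sub>R q x"
    proof cases
      case 1
      then show ?thesis using sublinear_zero[OF q(1)] by simp
    next
      case 2
      then show ?thesis using sublinear_scale[OF q(1)] by simp
    next
      case 3
      then show ?thesis using sublinear_scale[OF q(1) 3, of x] neg[of "c *\<^sub>R x"] by simp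
    qed
  qed (rule add)
  then show ?thesis using q(2) by (auto simp: le_fun_def)
qed

lemma separating_functional:
  fixes C :: "'v::real_normed_vector set"
  assumes C: "convex C" and norm: "\<And>c. c \<in> C \<Longrightarrow> 1 \<le> norm c"
  shows "\<exists>f :: 'v \<Rightarrow> real. linear f \<and> (\<forall>y. \<bar>f y\<bar> \<le> norm y) \<and> (\<forall>c\<in>C. 1 \<le> f c)"
proof (cases "C = {}")
  case True
  then show ?thesis by (intro exI[of _ "\<lambda>_. 0"]) (auto intro: linear_zero)
next
  case False
  have "sublinear (norm :: 'v \<Rightarrow> real)"
    by (rule sublinearI) (auto intro: norm_triangle_ineq)
  from sublinear_shift[OF this C False norm] obtain q :: "'v \<Rightarrow> real" where
    q: "sublinear q" "\<And>y. q y \<le> norm y" "\<And>c. c \<in> C \<Longrightarrow> q (- c) \<le> - 1" by blast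
  obtain f where f: "linear f" "\<And>x. f x \<le> q x"
    using linear_below_sublinear[OF q(1)] by blast
  have le: "f y \<le> norm y" for y
    using f(2) q(2) by (rule order_trans)
  have "\<bar>f y\<bar> \<le> norm y" for y
    using le[of y] le[of "- y"] linear_neg[OF f(1), of y] by simp
  moreover have "1 \<le> f c" if "c \<in> C" for c
    using f(2)[of "- c"] q(3)[OF that] linear_neg[OF f(1), of c] by simp
  ultimately show ?thesis using f(1) by blast
qed

section \<open>Isometries of spheres and convex sets\<close>

text \<open>
  The norm is a convex function; being \<open>1\<close> at both ends and at the midpoint of a segment, it is \<open>1\<close>
  throughout.
\<close>

lemma norm_segment_eq_1:
  fixes w k :: "'v::real_normed_vector"
  assumes "norm w = 1" "norm k = 1" "norm (w + k) = 2" "u \<ge> 0" "v \<ge> 0" "u + v = 1"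
  shows "norm (u *\<^sub>R w + v *\<^sub>R k) = 1"
proof -
  have *: "1 \<le> norm (u *\<^sub>R w + v *\<^sub>R k)"
    if "u \<le> v" "norm w = 1" "norm (w + k) = 2" "u \<ge> 0" "u + v = 1" for u v :: real and w k :: 'v
  proof -
    have "u *\<^sub>R w + v *\<^sub>R k = v *\<^sub>R (w + k) - (v - u) *\<^sub>R w"
      by (simp add: algebra_simps)
    then have "norm (v *\<^sub>R (w + k)) - norm ((v - u) *\<^sub>R w) \<le> norm (u *\<^sub>R w + v *\<^sub>R k)"
      by (metis norm_triangle_ineq2)
    then show ?thesis using that by simp
  qed
  have "1 \<le> norm (u *\<^sub>R w + v *\<^sub>R k)"
    using *[of u v w k] *[of v u k w] assms by (cases "u \<le> v") (auto simp: add.commute)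
  moreover have "norm (u *\<^sub>R w + v *\<^sub>R k) \<le> 1"
    using norm_triangle_ineq[of "u *\<^sub>R w" "v *\<^sub>R k"] assms by simp
  ultimately show ?thesis by simp
qed

text \<open>
  The condition \<open>norm (w + p) = 2\<close> says that the segment from \<open>w\<close> to \<open>p\<close> stays in the sphere.
  Every \<open>w\<close> in a convex subset \<open>D\<close> of the sphere has this property with respect to \<open>p \<in> D\<close>, hence by
  hypothesis with respect to \<open>k\<close>, and \<open>convex hull (insert k D)\<close> consists of the segments from \<open>k\<close>
  to points of \<open>D\<close>.
\<close>

lemma convex_hull_insert_in_sphere:
  fixes D :: "'v::real_normed_vector set"
  assumes D: "convex D" "D \<subseteq> unit_sphere UNIV" "p \<in> D" and k: "norm k = 1"
    and star: "\<And>w. norm w = 1 \<Longrightarrow> norm (w + p) = 2 \<Longrightarrow> norm (w + k) = 2"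
  shows "convex hull (insert k D) \<subseteq> unit_sphere UNIV"
proof
  fix x assume "x \<in> convex hull (insert k D)"
  then obtain u v w where x: "u \<ge> 0" "v \<ge> 0" "u + v = 1" "w \<in> D" "x = v *\<^sub>R w + u *\<^sub>R k"
    using D(1,3) by (subst (asm) convex_hull_insert) (auto simp: hull_same add.commute)
  have "(1/2) *\<^sub>R w + (1/2) *\<^sub>R p \<in> D"
    using x(4) D(1,3) by (intro convexD) auto
  then have "norm ((1/2) *\<^sub>R (w + p)) = 1"
    using D(2) by (auto simp: unit_sphere_def scaleR_add_right)
  then have "norm (w + p) = 2" by simp
  moreover have "norm w = 1"
    using x(4) D(2) by (auto simp: unit_sphere_def)
  ultimately have "norm x = 1"
    using norm_segment_eq_1[of w k v u] star k x by auto
  then show "x \<in> unit_sphere UNIV" by (simp add: unit_sphere_def)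
qed

lemma convex_hull_finite_in_sphere:
  fixes P :: "'v::real_normed_vector set"
  assumes P: "convex hull P \<subseteq> unit_sphere UNIV" and K: "finite K" "K \<subseteq> unit_sphere UNIV"
    and star: "\<And>k. k \<in> K \<Longrightarrow> \<exists>p\<in>P. \<forall>w. norm w = 1 \<longrightarrow> norm (w + p) = 2 \<longrightarrow> norm (w + k) = 2"
  shows "convex hull (K \<union> P) \<subseteq> unit_sphere UNIV"
  using K star
proof (induction K rule: finite_induct)
  case empty
  then show ?case using P by simp
next
  case (insert k K)
  obtain p where p: "p \<in> P" "\<And>w. norm w = 1 \<Longrightarrow> norm (w + p) = 2 \<Longrightarrow> norm (w + k) = 2"
    using insert.prems(2)[of k] by auto
  have "convex hull (insert k (convex hull (K \<union> P))) \<subseteq> unit_sphere UNIV"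
    by (rule convex_hull_insert_in_sphere[of _ p])
      (use insert p in \<open>auto simp: unit_sphere_def hull_inc\<close>)
  moreover have "convex hull (insert k K \<union> P) \<subseteq> convex hull (insert k (convex hull (K \<union> P)))"
    by (rule hull_mono) (auto simp: hull_inc)
  ultimately show ?case by blast
qed

text \<open>
  Such an \<open>m\<close> is an iterated midpoint of the points of \<open>H\<close>: if \<open>n\<close> is the midpoint of \<open>m\<close> and \<open>h\<close>, then
  \<open>z + n\<close> is the midpoint of \<open>z + m\<close> and \<open>z + h\<close>, so if \<open>z + n\<close> has norm \<open>2\<close>, both of these have.
\<close>

lemma star_centre:
  fixes C :: "'v::real_normed_vector set"
  assumes C: "convex C" "C \<subseteq> unit_sphere UNIV" and H: "finite H" "H \<subseteq> C" and ne: "C \<noteq> {}"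
  shows "\<exists>m\<in>C. \<forall>h\<in>H. \<forall>z. norm z = 1 \<longrightarrow> norm (z + m) = 2 \<longrightarrow> norm (z + h) = 2"
  using H
proof (induction H rule: finite_induct)
  case empty
  then show ?case using ne by auto
next
  case (insert h H)
  then obtain m where m: "m \<in> C" "\<And>h z. h \<in> H \<Longrightarrow> norm z = 1 \<Longrightarrow> norm (z + m) = 2 \<Longrightarrow> norm (z + h) = 2"
    by auto
  define n where "n = (1/2) *\<^sub>R m + (1/2) *\<^sub>R h"
  have "n \<in> C"
    unfolding n_def using m(1) insert.prems C(1) by (intro convexD) auto
  moreover have "norm (z + m) = 2 \<and> norm (z + h) = 2" if "norm z = 1" "norm (z + n) = 2" for z
  proof -
    have "norm m = 1" "norm h = 1"
      using m(1) insert.prems C(2) by (auto simp: unit_sphere_def)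
    then have "norm (z + m) \<le> 2" "norm (z + h) \<le> 2"
      using norm_triangle_ineq[of z m] norm_triangle_ineq[of z h] that by auto
    moreover have "z + n = (1/2) *\<^sub>R (z + m) + (1/2) *\<^sub>R (z + h)"
      unfolding n_def by (simp add: algebra_simps flip: scaleR_add_left)
    then have "2 \<le> norm ((1/2) *\<^sub>R (z + m)) + norm ((1/2) *\<^sub>R (z + h))"
      using that(2) norm_triangle_ineq by metis
    ultimately show ?thesis by simp
  qed
  ultimately show ?case using m(2) by (intro bexI[of _ n]) auto
qed

text \<open>
  An isometry between spheres preserves the relation \<open>norm (x - y) = 2\<close>, and this suffices to see that
  \<open>T\<close> maps convex subsets of the sphere into faces, although it is not assumed to respect convex
  combinations. For finitely many points \<open>h\<close> of \<open>C\<close> let \<open>m\<close> be a common centre as in the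
  lemma above. Since \<open>T m\<close> and \<open>T (- m)\<close> have distance \<open>2\<close>, the segment from \<open>T m\<close> to \<open>- T (- m)\<close> lies
  in the sphere. A point of the sphere at distance \<open>2\<close> from \<open>- T m\<close> is \<open>- T z\<close> with \<open>z\<close> at distance
  \<open>2\<close> from \<open>m\<close>, hence from every \<open>h\<close>; so it is at distance \<open>2\<close> from \<open>- T h\<close>. In the same way
  distance \<open>2\<close> from \<open>T (- m)\<close> entails distance \<open>2\<close> from \<open>T (- h)\<close>. Thus the points \<open>T h\<close> and
  \<open>- T (- h)\<close> can be adjoined one after the other, and Hahn--Banach applies to the convex hull.
\<close>

lemma convex_face_functional:
  fixes T :: "'v::real_normed_vector \<Rightarrow> 'w::real_normed_vector"
  assumes T: "surj_isometry (unit_sphere B) (unit_sphere UNIV) T"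
    and B: "\<And>x. x \<in> B \<Longrightarrow> - x \<in> B"
    and C: "convex C" "C \<subseteq> unit_sphere B"
  shows "\<exists>f :: 'w \<Rightarrow> real. linear f \<and> (\<forall>y. \<bar>f y\<bar> \<le> norm y) \<and>
    (\<forall>h\<in>C. f (T h) = 1 \<and> f (T (- h)) = - 1)"
proof -
  have dist: "norm (T x - T y) = norm (x - y)" if "x \<in> unit_sphere B" "y \<in> unit_sphere B" for x y
    using T that by (auto simp: surj_isometry_def dist_norm)
  have T1: "norm (T x) = 1" if "x \<in> unit_sphere B" for x
    using T that by (auto simp: surj_isometry_def unit_sphere_def)
  have onto: "\<exists>x\<in>unit_sphere B. T x = y" if "norm y = 1" for y
  proof -
    have "y \<in> T ` unit_sphere B"
      using T that by (simp add: surj_isometry_def unit_sphere_def)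
    then show ?thesis by auto
  qed
  have CB: "h \<in> unit_sphere B" "- h \<in> unit_sphere B" if "h \<in> C" for h
    using that C(2) B by (auto simp: unit_sphere_def)
  define S where "S = T ` C \<union> (\<lambda>h. - T (- h)) ` C"
  have S1: "norm y = 1" if "y \<in> S" for y
    using that CB T1 by (auto simp: S_def)
  have hull1: "1 \<le> norm y" if y: "y \<in> convex hull S" for y
  proof -
    obtain K u where K: "finite K" "K \<subseteq> S" "\<And>x. x \<in> K \<Longrightarrow> 0 \<le> u x" "sum u K = 1"
      "(\<Sum>v\<in>K. u v *\<^sub>R v) = y"
      using y by (auto simp: convex_hull_explicit)
    have "C \<noteq> {}"
      using K(2,4) by (auto simp: S_def)
    obtain H where H: "finite H" "H \<subseteq> C" "K \<subseteq> T ` H \<union> (\<lambda>h. - T (- h)) ` H"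
    proof -
      obtain H1 where H1: "H1 \<subseteq> C" "finite H1" "K \<inter> T ` C = T ` H1"
        using finite_subset_image[of "K \<inter> T ` C" T C] K(1) by auto
      obtain H2 where H2: "H2 \<subseteq> C" "finite H2" "K \<inter> (\<lambda>h. - T (- h)) ` C = (\<lambda>h. - T (- h)) ` H2"
        using finite_subset_image[of "K \<inter> (\<lambda>h. - T (- h)) ` C" "\<lambda>h. - T (- h)" C] K(1) by auto
      have "K \<subseteq> (K \<inter> T ` C) \<union> (K \<inter> (\<lambda>h. - T (- h)) ` C)"
        using K(2) unfolding S_def by blast
      also have "\<dots> \<subseteq> T ` (H1 \<union> H2) \<union> (\<lambda>h. - T (- h)) ` (H1 \<union> H2)"
        unfolding H1(3) H2(3) by blast
      finally show ?thesis using H1 H2 by (intro that[of "H1 \<union> H2"]) auto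
    qed
    obtain m where m: "m \<in> C"
      "\<And>h z. h \<in> H \<Longrightarrow> norm z = 1 \<Longrightarrow> norm (z + m) = 2 \<Longrightarrow> norm (z + h) = 2"
      using star_centre[OF C(1) _ H(1,2) \<open>C \<noteq> {}\<close>] C(2) by (auto simp: unit_sphere_def subset_iff)
    define P where "P = {T m, - T (- m)}"
    have "norm (T m - T (- m)) = 2"
      using dist[OF CB[OF m(1)]] CB(1)[OF m(1)] by (simp add: unit_sphere_def flip: scaleR_2)
    then have P: "convex hull P \<subseteq> unit_sphere UNIV"
      unfolding P_def using norm_segment_eq_1[of "T m" "- T (- m)"] T1 CB[OF m(1)]
      by (auto simp: convex_hull_2 unit_sphere_def)
    have "convex hull (K \<union> P) \<subseteq> unit_sphere UNIV"
    proof (rule convex_hull_finite_in_sphere[OF P K(1)])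
      show "K \<subseteq> unit_sphere UNIV"
        using K(2) S1 by (auto simp: unit_sphere_def)
      fix k assume "k \<in> K"
      then consider h where "h \<in> H" "k = T h" | h where "h \<in> H" "k = - T (- h)"
        using H(3) by auto
      then show "\<exists>p\<in>P. \<forall>w. norm w = 1 \<longrightarrow> norm (w + p) = 2 \<longrightarrow> norm (w + k) = 2"
      proof cases
        case 1
        have "norm (w + T h) = 2" if w: "norm w = 1" "norm (w + T m) = 2" for w
        proof -
          obtain z where z: "z \<in> unit_sphere B" "T z = - w" using onto[of "- w"] w(1) by auto
          have hC: "h \<in> C" using 1 H by auto
          have "norm (- z + m) = 2"
            using dist[OF z(1) CB(1)[OF m(1)]] w(2) z(2) norm_minus_commute[of m z]
              norm_minus_cancel[of "w + T m"] by simp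
          then have "norm (- z + h) = 2"
            using m(2)[of h "- z"] 1 z(1) by (auto simp: unit_sphere_def)
          then show ?thesis
            using dist[OF z(1) CB(1)[OF hC]] z(2) norm_minus_commute[of h z]
              norm_minus_cancel[of "w + T h"] by simp
        qed
        then show ?thesis using 1 by (auto simp: P_def)
      next
        case 2
        have "norm (w - T (- h)) = 2" if w: "norm w = 1" "norm (w - T (- m)) = 2" for w
        proof -
          obtain z where z: "z \<in> unit_sphere B" "T z = w" using onto[of w] w(1) by auto
          have hC: "h \<in> C" using 2 H by auto
          have "norm (z + m) = 2"
            using dist[OF z(1) CB(2)[OF m(1)]] w(2) z(2) by simp
          then have "norm (z + h) = 2"
            using m(2) 2 z(1) by (auto simp: unit_sphere_def)
          then show ?thesis
            using dist[OF z(1) CB(2)[OF hC]] z(2) by simp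
        qed
        then show ?thesis using 2 by (auto simp: P_def)
      qed
    qed
    moreover have "y \<in> convex hull (K \<union> P)"
    proof -
      have "y \<in> convex hull K"
        unfolding K(5)[symmetric] by (rule convex_sum) (use K in \<open>auto simp: hull_inc\<close>)
      then show ?thesis using hull_mono[of K "K \<union> P" convex] by blast
    qed
    ultimately show ?thesis by (auto simp: unit_sphere_def)
  qed
  obtain f :: "'w \<Rightarrow> real" where f: "linear f" "\<And>y. \<bar>f y\<bar> \<le> norm y" "\<And>c. c \<in> convex hull S \<Longrightarrow> 1 \<le> f c"
    using separating_functional[OF convex_convex_hull hull1] by blast
  have "f y = 1" if "y \<in> S" for y
    using f(2)[of y] f(3)[of y] S1[OF that] hull_inc[OF that, of convex] by auto
  then have "f (T h) = 1 \<and> f (T (- h)) = - 1" if "h \<in> C" for h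
    using that linear_neg[OF f(1), of "T (- h)"] by (fastforce simp: S_def)
  then show ?thesis using f by blast
qed

section \<open>Functional calculus in a uniform algebra\<close>

locale unif_alg =
  fixes A :: "('x::t2_space \<Rightarrow>\<^sub>C complex) set"
  assumes ua: "uniform_algebra A"
begin

lemma rep_eqs:
  "apply_bcontfun (scaleC_bcontfun c f) y = c * apply_bcontfun f y"
  "apply_bcontfun (times_bcontfun f g) y = apply_bcontfun f y * apply_bcontfun g y"
  "apply_bcontfun (Re_bcontfun f) y = Re (apply_bcontfun f y)"
  by (simp_all add: scaleC_bcontfun_def times_bcontfun.rep_eq Re_bcontfun.rep_eq)

lemma compact_UNIV: "compact (UNIV :: 'x set)"
  using ua by (simp add: uniform_algebra_def)

lemma closed_A: "closed A"
  using ua by (simp add: uniform_algebra_def)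

lemma subspace_A: "module.subspace scaleC_bcontfun A"
  using ua by (simp add: uniform_algebra_def)

lemma module_scaleC: "module (scaleC_bcontfun :: complex \<Rightarrow> ('x \<Rightarrow>\<^sub>C complex) \<Rightarrow> _)"
  using normed_space_over_scaleC unfolding normed_space_over_def vector_space_def module_def by blast

lemmas A_add = module.subspace_add[OF module_scaleC subspace_A]
  and A_scale = module.subspace_scale[OF module_scaleC subspace_A]
  and A_diff = module.subspace_diff[OF module_scaleC subspace_A]
  and A_sum = module.subspace_sum[OF module_scaleC subspace_A]

lemma A_const: "const_bcontfun c \<in> A"
  using ua by (auto simp: uniform_algebra_def)

lemma A_times: "f \<in> A \<Longrightarrow> g \<in> A \<Longrightarrow> times_bcontfun f g \<in> A"
  using ua by (auto simp: uniform_algebra_def)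

lemma apply_sum: "apply_bcontfun (sum f I) y = (\<Sum>i\<in>I. apply_bcontfun (f i) y)"
  by (induction I rule: infinite_finite_induct) simp_all

lemma polynomial_in_A:
  assumes "f \<in> A"
  shows "\<exists>g\<in>A. \<forall>y. apply_bcontfun g y = (\<Sum>k<n. c k * apply_bcontfun f y ^ k)"
proof (induction n arbitrary: c)
  case 0
  show ?case using A_const[of 0] by (intro bexI[of _ "const_bcontfun 0"]) auto
next
  case (Suc n)
  obtain g where g: "g \<in> A" "\<And>y. apply_bcontfun g y = (\<Sum>k<n. c (Suc k) * apply_bcontfun f y ^ k)"
    using Suc[of "\<lambda>k. c (Suc k)"] by auto
  show ?case
    by (rule bexI[of _ "const_bcontfun (c 0) + times_bcontfun f g"])
      (auto simp: sum.lessThan_Suc_shift rep_eqs g(2) sum_distrib_left mult_ac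
        simp del: sum.lessThan_Suc intro!: A_add A_const A_times assms g(1))
qed

text \<open>
  Closedness of the algebra, in a form for which the limit need not be given as a bounded
  continuous function beforehand.
\<close>

lemma uniform_limit_in_A:
  assumes g: "continuous_on UNIV g" 
    and approx: "\<And>\<epsilon>. \<epsilon> > 0 \<Longrightarrow> \<exists>f\<in>A. \<forall>y. norm (apply_bcontfun f y - g y) \<le> \<epsilon>"
  shows "\<exists>f\<in>A. apply_bcontfun f = g"
proof -
  have "g \<in> bcontfun"
    using g compact_continuous_image[OF g compact_UNIV] by (auto simp: bcontfun_def intro: compact_imp_bounded)
  define G where "G = Bcontfun g"
  have G: "apply_bcontfun G = g"
    unfolding G_def by (rule Bcontfun_inverse) fact
  have "\<exists>f\<in>A. dist f G < e" if e: "e > 0" for e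
  proof -
    obtain f where f: "f \<in> A" "\<And>y. norm (apply_bcontfun f y - g y) \<le> e / 2"
      using approx[of "e / 2"] e by auto
    have "dist f G \<le> e / 2"
      by (rule dist_bound) (use f(2) in \<open>simp add: dist_norm G\<close>)
    then show ?thesis using f(1) e by (intro bexI[of _ f]) auto
  qed
  then have "G \<in> closure A"
    by (simp add: closure_approachable)
  then have "G \<in> A"
    using closed_A by simp
  then show ?thesis using G by blast
qed

text \<open>
  The dilations \<open>z \<mapsto> h (r z)\<close> with \<open>r < 1\<close> converge to \<open>h\<close> uniformly on the closed disc, and the Taylor
  series of each of them converges uniformly there. So \<open>h\<close> is a uniform limit of polynomials.
\<close>

lemma disc_algebra_calculus:
  assumes f: "f \<in> A" "\<And>y. norm (apply_bcontfun f y) \<le> 1"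
    and h: "h holomorphic_on ball 0 1" "continuous_on (cball 0 1) h"
  shows "\<exists>g\<in>A. \<forall>y. apply_bcontfun g y = h (apply_bcontfun f y)"
proof -
  have dil: "\<exists>g\<in>A. apply_bcontfun g = (\<lambda>y. h (of_real r * apply_bcontfun f y))"
    if r: "0 < r" "r < 1" for r :: real
  proof (rule uniform_limit_in_A)
    have "norm (of_real r * apply_bcontfun f y) \<le> 1" for y
      using r f(2)[of y] by (simp add: norm_mult mult_le_one)
    then show "continuous_on UNIV (\<lambda>y. h (of_real r * apply_bcontfun f y))"
      by (intro continuous_on_compose2[OF h(2)] continuous_intros) auto
  next
    fix \<epsilon> :: real assume eps: "\<epsilon> > 0"
    define c where "c n = (deriv ^^ n) h 0 / fact n" for n
    have sums: "(\<lambda>n. c n * z ^ n) sums h z" if "norm z < 1" for z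
      using holomorphic_power_series[OF h(1), of z] that by (simp add: c_def)
    define r' where "r' = (r + 1) / 2"
    have "summable (\<lambda>n. c n * of_real r' ^ n)"
      using sums[of "of_real r'"] r by (auto simp: r'_def sums_iff)
    from powser_insidea[OF this, of "of_real r"]
    have summ: "summable (\<lambda>n. norm (c n * of_real r ^ n))"
      using r by (simp add: r'_def)
    have "uniform_limit (cball 0 1) (\<lambda>n z. \<Sum>k<n. c k * of_real r ^ k * z ^ k)
      (\<lambda>z. \<Sum>k. c k * of_real r ^ k * z ^ k) sequentially"
    proof (rule Weierstrass_m_test[OF _ summ])
      fix n and z :: complex assume "z \<in> cball 0 1"
      then have "norm z ^ n \<le> 1" by (auto intro: power_le_one)
      then show "norm (c n * of_real r ^ n * z ^ n) \<le> norm (c n * of_real r ^ n)"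
        by (simp add: norm_mult norm_power mult_left_le)
    qed
    from uniform_limitD[OF this eps] obtain n where
      n: "\<And>z. norm z \<le> 1 \<Longrightarrow> dist (\<Sum>k<n. c k * of_real r ^ k * z ^ k) (\<Sum>k. c k * of_real r ^ k * z ^ k) < \<epsilon>"
      by (force simp: eventually_sequentially)
    obtain g where g: "g \<in> A"
      "\<And>y. apply_bcontfun g y = (\<Sum>k<n. (c k * of_real r ^ k) * apply_bcontfun f y ^ k)"
      using polynomial_in_A[OF f(1), where n = n and c = "\<lambda>k. c k * of_real r ^ k"] by blast
    have "norm (apply_bcontfun g y - h (of_real r * apply_bcontfun f y)) \<le> \<epsilon>" for y
    proof -
      have "norm (of_real r * apply_bcontfun f y) \<le> r"
        using r f(2)[of y] by (simp add: norm_mult)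
      then have "norm (of_real r * apply_bcontfun f y) < 1" using r by linarith
      from sums[OF this] have "(\<Sum>k. c k * of_real r ^ k * apply_bcontfun f y ^ k) = h (of_real r * apply_bcontfun f y)"
        by (simp add: sums_iff power_mult_distrib mult.assoc)
      then show ?thesis
        using n[OF f(2)[of y]] by (simp add: g(2) dist_norm)
    qed
    then show "\<exists>g\<in>A. \<forall>y. norm (apply_bcontfun g y - h (of_real r * apply_bcontfun f y)) \<le> \<epsilon>"
      using g(1) by blast
  qed
  have "\<exists>g\<in>A. apply_bcontfun g = (\<lambda>y. h (apply_bcontfun f y))"
  proof (rule uniform_limit_in_A)
    show "continuous_on UNIV (\<lambda>y. h (apply_bcontfun f y))"
      by (intro continuous_on_compose2[OF h(2)] continuous_intros) (use f(2) in auto)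
  next
    fix \<epsilon> :: real assume eps: "\<epsilon> > 0"
    have "uniformly_continuous_on (cball 0 1) h"
      by (rule compact_uniformly_continuous[OF h(2)]) auto
    then obtain d where d: "d > 0" "\<And>z z'. norm z \<le> 1 \<Longrightarrow> norm z' \<le> 1 \<Longrightarrow> dist z' z < d \<Longrightarrow> dist (h z') (h z) < \<epsilon>"
      using eps unfolding uniformly_continuous_on_def by (metis mem_cball_0)
    define r where "r = max (1/2) (1 - d / 2)"
    have r: "0 < r" "r < 1" "1 - r < d"
      using d(1) by (auto simp: r_def max_def)
    obtain g where g: "g \<in> A" "apply_bcontfun g = (\<lambda>y. h (of_real r * apply_bcontfun f y))"
      using dil[OF r(1,2)] by blast
    have "norm (apply_bcontfun g y - h (apply_bcontfun f y)) \<le> \<epsilon>" for y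
    proof -
      let ?z = "apply_bcontfun f y"
      have "of_real r * ?z - ?z = - (of_real (1 - r) * ?z)" by (simp add: algebra_simps)
      then have "norm (of_real r * ?z - ?z) = (1 - r) * norm ?z"
        using r by (simp only: norm_minus_cancel norm_mult norm_of_real)
      also have "\<dots> < d" using f(2)[of y] r by (smt (verit) mult_left_le)
      finally have "dist (of_real r * ?z) ?z < d" by (simp add: dist_norm)
      moreover have "norm (of_real r * ?z) \<le> 1"
        using r f(2)[of y] by (simp add: norm_mult mult_le_one)
      ultimately show ?thesis
        using d(2)[OF f(2)[of y], of "of_real r * ?z"] by (simp add: g(2) dist_norm)
    qed
    then show "\<exists>g\<in>A. \<forall>y. norm (apply_bcontfun g y - h (apply_bcontfun f y)) \<le> \<epsilon>"
      using g(1) by blast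
  qed
  then show ?thesis by (auto simp: fun_eq_iff)
qed

lemma fractional_power_in_A:
  assumes f: "f \<in> A" "\<And>y. norm (apply_bcontfun f y) \<le> 1" and s: "s > 0"
  shows "\<exists>w\<in>A. \<forall>y. apply_bcontfun w y = ((1 - apply_bcontfun f y) / 2) powr of_real s"
proof (rule disc_algebra_calculus[OF f])
  have *: "(1 - z) / 2 \<notin> \<real>\<^sub>\<le>\<^sub>0" if "z \<in> ball 0 1" for z :: complex
    using complex_Re_le_cmod[of z] that by (auto simp: complex_nonpos_Reals_iff)
  show "(\<lambda>z. ((1 - z) / 2) powr of_real s) holomorphic_on ball 0 1"
    by (intro holomorphic_intros) (use * in auto)
  have "0 \<le> Re ((1 - z) / 2)" if "norm z \<le> 1" for z :: complex
    using complex_Re_le_cmod[of z] that by simp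
  then show "continuous_on (cball 0 1) (\<lambda>z::complex. ((1 - z) / 2) powr of_real s)"
    by (intro continuous_intros) (use s in auto)
qed

end

text \<open>
  Small fractional powers map the right half of the unit disc into a narrow sector around the
  interval \<open>[0,1]\<close>.
\<close>

lemma sector_powr:
  assumes z: "Re z \<ge> 0" "norm z \<le> 1" and s: "0 < s" "s \<le> 1/4"
  shows "norm (z powr of_real s) = norm z powr s"
    and "\<bar>Im (z powr of_real s)\<bar> \<le> 2 * s * norm (z powr of_real s)"
    and "norm (z powr of_real s) \<le> 2 * Re (z powr of_real s)"
proof -
  show n: "norm (z powr of_real s) = norm z powr s"
    by (simp add: norm_powr_real_powr')
  show im: "\<bar>Im (z powr of_real s)\<bar> \<le> 2 * s * norm (z powr of_real s)"
  proof (cases "z = 0")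
    case False
    have "Im (z powr of_real s) = norm (z powr of_real s) * sin (s * Im (Ln z))"
      using False by (simp add: powr_def Im_exp norm_exp_eq_Re)
    moreover have "\<bar>Im (Ln z)\<bar> \<le> pi / 2"
      using z(1) False Re_Ln_pos_le by blast
    then have "\<bar>s * Im (Ln z)\<bar> \<le> s * 2"
      using s pi_less_4 by (auto simp: abs_mult intro!: mult_left_mono)
    then have "\<bar>sin (s * Im (Ln z))\<bar> \<le> s * 2"
      using abs_sin_x_le_abs_x[of "s * Im (Ln z)"] by linarith
    ultimately show ?thesis
      by (simp add: abs_mult mult.commute[of _ "cmod _"] mult_left_mono)
  qed simp
  have "0 \<le> Re (z powr of_real s)"
  proof (cases "z = 0")
    case False
    have "\<bar>Im (Ln z)\<bar> \<le> pi / 2"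
      using z(1) False Re_Ln_pos_le by blast
    then have "\<bar>s * Im (Ln z)\<bar> \<le> 1 * (pi / 2)"
      unfolding abs_mult using s by (intro mult_mono) auto
    then have "0 \<le> cos (s * Im (Ln z))"
      by (intro cos_ge_zero) auto
    then show ?thesis using False by (simp add: powr_def Re_exp)
  qed simp
  moreover have "\<bar>Im (z powr of_real s)\<bar> \<le> norm (z powr of_real s) / 2"
    using im s mult_right_mono[of "2 * s" "1/2" "norm (z powr of_real s)"] by simp
  ultimately show "norm (z powr of_real s) \<le> 2 * Re (z powr of_real s)"
    using cmod_le[of "z powr of_real s"] by linarith
qed

section \<open>Peaking functions\<close>

context unif_alg
begin

text \<open>
  Consider \<open>(h i)\<close> as a map into a Hermitian space, and let \<open>P\<close> be the farthest point of its range from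
  the origin. The ball through \<open>P\<close> lies on one side of its tangent plane, so the complex-linear
  functional \<open>z \<mapsto> \<langle>z, P\<rangle> / \<langle>P, P\<rangle>\<close> has real part at most \<open>1\<close> on the range, with
  equality at \<open>P\<close> only; quantitatively,
  \<open>norm (z - P) ^ 2 = norm z ^ 2 + norm P ^ 2 - 2 Re \<langle>z, P\<rangle> \<le> 2 (norm P ^ 2 - Re \<langle>z, P\<rangle>)\<close>. Composed with
  the \<open>h i\<close>, it is a linear combination of elements of the algebra.
\<close>

lemma maximal_sum_squares_peak:
  assumes I: "finite I" and h: "\<And>i. i \<in> I \<Longrightarrow> h i \<in> A"
    and max: "\<And>y. (\<Sum>i\<in>I. (cmod (apply_bcontfun (h i) y))\<^sup>2) \<le> (\<Sum>i\<in>I. (cmod (apply_bcontfun (h i) x))\<^sup>2)"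
    and pos: "(\<Sum>i\<in>I. (cmod (apply_bcontfun (h i) x))\<^sup>2) > 0"
  shows "\<exists>f\<in>A. (\<forall>y. cmod (apply_bcontfun f y) \<le> 1) \<and> apply_bcontfun f x = 1 \<and>
    (\<forall>y. (\<Sum>i\<in>I. (cmod (apply_bcontfun (h i) y - apply_bcontfun (h i) x))\<^sup>2) \<le>
      2 * (\<Sum>i\<in>I. (cmod (apply_bcontfun (h i) x))\<^sup>2) * (1 - Re (apply_bcontfun f y)))"
proof -
  define N where "N y = (\<Sum>i\<in>I. (cmod (apply_bcontfun (h i) y))\<^sup>2)" for y
  \<comment> \<open>\<open>p y\<close> is the Hermitian product of the values of the family at \<open>y\<close> and at \<open>x\<close>.\<close>
  define p where "p y = (\<Sum>i\<in>I. cnj (apply_bcontfun (h i) x) * apply_bcontfun (h i) y)" for y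
  define f where "f = scaleC_bcontfun (1 / of_real (N x)) (\<Sum>i\<in>I. scaleC_bcontfun (cnj (apply_bcontfun (h i) x)) (h i))"
  have fA: "f \<in> A"
    unfolding f_def by (intro A_scale A_sum h)
  have f: "apply_bcontfun f y = p y / of_real (N x)" for y
    by (simp add: f_def p_def rep_eqs apply_sum)
  have Nx: "N x > 0" and Nle: "N y \<le> N x" for y
    using pos max by (simp_all add: N_def)
  have "cmod (p y) \<le> N x" for y
  proof -
    have "cmod (p y) \<le> (\<Sum>i\<in>I. cmod (apply_bcontfun (h i) x) * cmod (apply_bcontfun (h i) y))"
      unfolding p_def by (rule sum_norm_le) (simp add: norm_mult)
    also have "\<dots> \<le> (\<Sum>i\<in>I. ((cmod (apply_bcontfun (h i) x))\<^sup>2 + (cmod (apply_bcontfun (h i) y))\<^sup>2) / 2)"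
      by (rule sum_mono) (use sum_squares_bound[where 'a = real] in \<open>simp add: mult.assoc mult.commute[of _ 2]\<close>)
    also have "\<dots> = (N x + N y) / 2"
      by (simp add: N_def sum.distrib flip: sum_divide_distrib)
    finally show ?thesis using Nle[of y] by simp
  qed
  then have "cmod (apply_bcontfun f y) \<le> 1" for y
    using Nx by (simp add: f norm_divide)
  moreover have "p x = of_real (N x)"
    unfolding p_def N_def of_real_sum by (rule sum.cong[OF refl]) (simp only: complex_norm_square mult.commute)
  then have "apply_bcontfun f x = 1"
    using Nx by (simp add: f)
  moreover have "(\<Sum>i\<in>I. (cmod (apply_bcontfun (h i) y - apply_bcontfun (h i) x))\<^sup>2) \<le>
      2 * N x * (1 - Re (apply_bcontfun f y))" for y
  proof -
    have "(cmod (a - b))\<^sup>2 = (cmod a)\<^sup>2 + (cmod b)\<^sup>2 - 2 * Re (cnj b * a)" for a b :: complex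
      unfolding cmod_power2 by (simp add: power2_eq_square algebra_simps)
    then have "(\<Sum>i\<in>I. (cmod (apply_bcontfun (h i) y - apply_bcontfun (h i) x))\<^sup>2) = N y + N x - 2 * Re (p y)"
      by (simp add: N_def p_def sum.distrib sum_subtractf sum_distrib_left)
    also have "\<dots> \<le> 2 * N x * (1 - Re (apply_bcontfun f y))"
      using Nx Nle[of y] by (simp add: f field_simps)
    finally show ?thesis .
  qed
  ultimately show ?thesis
    using fA by (fold N_def) blast
qed

text \<open>
  This applies the previous lemma to the functions of \<open>H\<close> together with \<open>G + R\<close> for a large
  constant \<open>R\<close>. The sum of squares is then \<open>R ^ 2 + 2 R Re G\<close> up to a bounded term, so where it is
  maximal, \<open>Re G\<close> is almost maximal.
\<close>

lemma peak_near_maximum: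
  assumes H: "finite H" "H \<subseteq> A" and G: "G \<in> A" and eta: "\<eta> > 0"
  shows "\<exists>x. \<exists>f\<in>A. \<exists>K\<ge>0. (\<forall>y. cmod (apply_bcontfun f y) \<le> 1) \<and> apply_bcontfun f x = 1 \<and>
    (\<forall>F\<in>H. \<forall>y. (cmod (apply_bcontfun F y - apply_bcontfun F x))\<^sup>2 \<le> K * (1 - Re (apply_bcontfun f y))) \<and>
    (\<forall>y. Re (apply_bcontfun G y) \<le> Re (apply_bcontfun G x) + \<eta>)"
proof -
  define S where "S y = (\<Sum>F\<in>H. (cmod (apply_bcontfun F y))\<^sup>2) + (cmod (apply_bcontfun G y))\<^sup>2" for y
  define M where "M = (\<Sum>F\<in>H. (norm F)\<^sup>2) + (norm G)\<^sup>2"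
  have S: "0 \<le> S y" "S y \<le> M" for y
    by (auto simp: S_def M_def intro!: add_nonneg_nonneg sum_nonneg add_mono sum_mono power_mono norm_bounded)
  \<comment> \<open>The summand \<open>norm G + 1\<close> keeps \<open>G + R\<close>, hence the sum of squares, away from zero.\<close>
  define R where "R = M / \<eta> + norm G + 1"
  have "M \<ge> 0" using S[of undefined] by simp
  then have R: "R > norm G" "R > 0" "M \<le> \<eta> * R"
    using eta divide_nonneg_pos[OF \<open>M \<ge> 0\<close> eta] norm_ge_zero[of G]
    unfolding R_def by (linarith, linarith, simp add: distrib_left)
  define I where "I = insert None (Some ` H)"
  define h where "h i = (case i of None \<Rightarrow> G + const_bcontfun (of_real R) | Some F \<Rightarrow> F)" for i
  define N where "N y = (\<Sum>i\<in>I. (cmod (apply_bcontfun (h i) y))\<^sup>2)" for y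
  have I: "finite I" using H by (simp add: I_def)
  have hA: "h i \<in> A" if "i \<in> I" for i
    using that H A_add[OF G A_const] by (auto simp: I_def h_def)
  have N: "N y = S y + R\<^sup>2 + 2 * R * Re (apply_bcontfun G y)" for y
  proof -
    have "N y = (cmod (apply_bcontfun G y + of_real R))\<^sup>2 + (\<Sum>F\<in>H. (cmod (apply_bcontfun F y))\<^sup>2)"
      using H by (simp add: N_def I_def h_def sum.reindex)
    then show ?thesis
      unfolding S_def cmod_power2 by (simp add: power2_eq_square algebra_simps)
  qed
  have "continuous_on UNIV N"
    unfolding N_def by (intro continuous_intros continuous_on_apply_bcontfun)
  then obtain x where x: "\<And>y. N y \<le> N x"
    using continuous_attains_sup[OF compact_UNIV] by auto
  have Nx: "N x > 0"
  proof -
    have "\<bar>Re (apply_bcontfun G x)\<bar> \<le> norm G"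
      using abs_Re_le_cmod norm_bounded by (rule order_trans)
    then have "0 < cmod (apply_bcontfun (h None) x)"
      using R by (auto simp: h_def complex_eq_iff)
    then have "0 < (cmod (apply_bcontfun (h None) x))\<^sup>2" by simp
    also have "\<dots> \<le> N x"
      unfolding N_def by (rule member_le_sum[OF _ _ I]) (auto simp: I_def)
    finally show ?thesis .
  qed
  obtain f where f: "f \<in> A" "\<And>y. cmod (apply_bcontfun f y) \<le> 1" "apply_bcontfun f x = 1"
    "\<And>y. (\<Sum>i\<in>I. (cmod (apply_bcontfun (h i) y - apply_bcontfun (h i) x))\<^sup>2) \<le> 2 * N x * (1 - Re (apply_bcontfun f y))"
    using maximal_sum_squares_peak[of I h x] I hA x Nx unfolding N_def by blast
  have "(cmod (apply_bcontfun F y - apply_bcontfun F x))\<^sup>2 \<le> (2 * N x) * (1 - Re (apply_bcontfun f y))"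
    if "F \<in> H" for F y
  proof -
    have "(cmod (apply_bcontfun (h (Some F)) y - apply_bcontfun (h (Some F)) x))\<^sup>2
        \<le> (\<Sum>i\<in>I. (cmod (apply_bcontfun (h i) y - apply_bcontfun (h i) x))\<^sup>2)"
      by (rule member_le_sum[OF _ _ I]) (use that in \<open>auto simp: I_def\<close>)
    then show ?thesis using f(4)[of y] by (simp add: h_def)
  qed
  moreover have "Re (apply_bcontfun G y) \<le> Re (apply_bcontfun G x) + \<eta>" for y
  proof -
    have "2 * (R * Re (apply_bcontfun G y)) \<le> 2 * (R * Re (apply_bcontfun G x)) + \<eta> * R"
      using x[of y] S(1)[of y] S(2)[of x] R(3) unfolding N by linarith
    also have "\<dots> \<le> 2 * (R * (Re (apply_bcontfun G x) + \<eta>))"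
      using R(2) eta by (simp add: algebra_simps)
    finally show ?thesis using R(2) by simp
  qed
  ultimately show ?thesis
    using f(1-3) Nx by (intro exI[of _ x] bexI[of _ f] exI[of _ "2 * N x"]) auto
qed

end

text \<open>
  For a small exponent \<open>s\<close>, the power \<open>v\<close> to the \<open>s\<close> is close to \<open>1\<close> unless \<open>v\<close> is very small, and it
  dominates \<open>sqrt (norm v)\<close> by an arbitrarily large factor when \<open>v\<close> is small. The threshold \<open>\<delta>\<close>
  between the two cases depends on \<open>K\<close> and \<open>\<eta>\<close> only, provided that \<open>s \<le> 1/4\<close>; this is why \<open>s\<close> can be
  chosen after \<open>\<delta>\<close>.
\<close>

lemma small_power_dichotomy:
  fixes K \<eta> :: real
  assumes K: "K \<ge> 0" and eta: "\<eta> > 0"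
  shows "\<exists>s>0. \<forall>v. Re v \<ge> 0 \<longrightarrow> cmod v \<le> 1 \<longrightarrow>
    (let w = v powr of_real s in cmod w \<le> 1 \<and> 0 \<le> Re w \<and> \<bar>Im w\<bar> \<le> \<eta> \<and>
      (K * sqrt (cmod v) \<le> \<eta> * Re w \<or> cmod (1 - w) \<le> \<eta>))"
proof -
  define r where "r = \<eta> / (2 * (K + 1))"
  define \<delta> where "\<delta> = r ^ 4"
  have r: "r > 0" "2 * K * r \<le> \<eta>"
    using K eta by (auto simp: r_def field_simps)
  have "\<delta> > 0" using r by (simp add: \<delta>_def)
  then have "((\<lambda>s. \<delta> powr s) \<longlongrightarrow> \<delta> powr 0) (at_right 0)"
    by (intro tendsto_intros) auto
  then have "\<forall>\<^sub>F s in at_right 0. 1 - \<eta> / 2 < \<delta> powr s"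
    using \<open>\<delta> > 0\<close> eta by (intro order_tendstoD(1)) auto
  moreover have "\<forall>\<^sub>F s in at_right 0. s < min (1/4) (\<eta> / 8)"
    using eta by (intro order_tendstoD(2)[OF tendsto_ident_at]) auto
  moreover have "\<forall>\<^sub>F s in at_right (0::real). 0 < s"
    by (rule eventually_at_right_less)
  ultimately have "\<forall>\<^sub>F s in at_right 0. 1 - \<eta> / 2 < \<delta> powr s \<and> s < min (1/4) (\<eta> / 8) \<and> 0 < s"
    by eventually_elim auto
  then obtain s where s: "1 - \<eta> / 2 < \<delta> powr s" "s < 1/4" "s < \<eta> / 8" "s > 0"
    using eventually_happens'[OF trivial_limit_at_right_real] by auto
  have "cmod w \<le> 1 \<and> 0 \<le> Re w \<and> \<bar>Im w\<bar> \<le> \<eta> \<and> (K * sqrt (cmod v) \<le> \<eta> * Re w \<or> cmod (1 - w) \<le> \<eta>)"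
    if v: "Re v \<ge> 0" "cmod v \<le> 1" and w_def: "w = v powr of_real s" for v w
  proof -
    note sector = sector_powr[OF v, of s, folded w_def]
    have w: "cmod w = cmod v powr s" "\<bar>Im w\<bar> \<le> 2 * s * cmod w" "cmod w \<le> 2 * Re w"
      using sector s by auto
    have w1: "cmod w \<le> 1"
      using w(1) v(2) s by (simp add: powr_le1)
    have Re0: "0 \<le> Re w"
      using w(3) norm_ge_zero[of w] by linarith
    have "2 * s * cmod w \<le> 2 * s"
      using w1 s by (simp add: mult_left_le)
    then have Im: "\<bar>Im w\<bar> \<le> 2 * s" using w(2) by linarith
    have "K * sqrt (cmod v) \<le> \<eta> * Re w \<or> cmod (1 - w) \<le> \<eta>"
    proof (cases "cmod v \<le> \<delta>")
      case True
      \<comment> \<open>One factor is small because \<open>v\<close> is; the other one is below the power of \<open>v\<close> as \<open>s \<le> 1/4\<close>.\<close>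
      have "sqrt (cmod v) = cmod v powr (1/4) * cmod v powr (1/4)"
        by (simp add: powr_half_sqrt flip: powr_add)
      also have "\<dots> \<le> r * cmod w"
      proof (intro mult_mono)
        have "cmod v powr (1/4) \<le> \<delta> powr (1/4)"
          using True by (intro powr_mono2) auto
        also have "\<dots> = r"
          using r by (simp add: \<delta>_def powr_powr flip: powr_numeral)
        finally show "cmod v powr (1/4) \<le> r" .
        show "cmod v powr (1/4) \<le> cmod w"
          unfolding w(1) using v(2) s by (intro powr_mono') auto
      qed (use r in auto)
      finally have "K * sqrt (cmod v) \<le> K * (r * (2 * Re w))"
        using K r w(3) by (intro mult_left_mono) (auto intro: order_trans)
      also have "\<dots> = (2 * K * r) * Re w" by simp
      also have "\<dots> \<le> \<eta> * Re w"
        using r(2) Re0 by (rule mult_right_mono)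
      finally show ?thesis ..
    next
      case False
      have "\<delta> powr s \<le> cmod w"
        unfolding w(1) using False \<open>\<delta> > 0\<close> s by (intro powr_mono2) auto
      moreover have "cmod w \<le> Re w + \<bar>Im w\<bar>"
        using cmod_le[of w] Re0 by simp
      moreover have "cmod (1 - w) \<le> (1 - Re w) + \<bar>Im w\<bar>"
        using cmod_le[of "1 - w"] complex_Re_le_cmod[of w] w1 by simp
      ultimately have "cmod (1 - w) \<le> \<eta>"
        using Im s by linarith
      then show ?thesis ..
    qed
    then show ?thesis using w1 Re0 Im s by auto
  qed
  then show ?thesis using s(4) unfolding Let_def by blast
qed

context unif_alg
begin

text \<open>
  With \<open>f\<close> from \<open>peak_near_maximum\<close> and \<open>v = (1 - f) / 2\<close>, the oscillation of the functions of \<open>H\<close> around \<open>x\<close>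
  is at most a multiple of \<open>sqrt (norm v)\<close>, so \<open>w\<close> can be taken as a small power of \<open>v\<close>. The function
  \<open>1 - w\<close> plays the role of a bump function in the algebra: it is \<open>1\<close> at \<open>x\<close>, almost real with
  values close to \<open>[0,1]\<close>, and where it is not small the functions of \<open>H\<close> are almost constant.
\<close>

lemma sector_peaking_function:
  assumes H: "finite H" "H \<subseteq> A" and G: "G \<in> A" and eta: "\<eta> > 0"
  shows "\<exists>x. \<exists>w\<in>A. apply_bcontfun w x = 0 \<and>
    (\<forall>y. cmod (apply_bcontfun w y) \<le> 1 \<and> 0 \<le> Re (apply_bcontfun w y) \<and> \<bar>Im (apply_bcontfun w y)\<bar> \<le> \<eta> \<and>
      ((\<forall>F\<in>H. cmod (apply_bcontfun F y - apply_bcontfun F x) \<le> \<eta> * Re (apply_bcontfun w y))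
        \<or> cmod (1 - apply_bcontfun w y) \<le> \<eta>) \<and>
      Re (apply_bcontfun G y) \<le> Re (apply_bcontfun G x) + \<eta>)"
proof -
  obtain x f K where f: "f \<in> A" "\<And>y. cmod (apply_bcontfun f y) \<le> 1" "apply_bcontfun f x = 1" and K: "K \<ge> 0"
    and F: "\<And>F y. F \<in> H \<Longrightarrow> (cmod (apply_bcontfun F y - apply_bcontfun F x))\<^sup>2 \<le> K * (1 - Re (apply_bcontfun f y))"
    and Gx: "\<And>y. Re (apply_bcontfun G y) \<le> Re (apply_bcontfun G x) + \<eta>"
    using peak_near_maximum[OF assms] by blast
  obtain s where s: "s > 0" and dich: "\<And>v. Re v \<ge> 0 \<Longrightarrow> cmod v \<le> 1 \<Longrightarrow>
    (let w = v powr of_real s in cmod w \<le> 1 \<and> 0 \<le> Re w \<and> \<bar>Im w\<bar> \<le> \<eta> \<and>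
      (sqrt (2 * K) * sqrt (cmod v) \<le> \<eta> * Re w \<or> cmod (1 - w) \<le> \<eta>))"
    using small_power_dichotomy[of "sqrt (2 * K)" \<eta>] K eta by auto
  obtain w where w: "w \<in> A" "\<And>y. apply_bcontfun w y = ((1 - apply_bcontfun f y) / 2) powr of_real s"
    using fractional_power_in_A[OF f(1,2) s] by blast
  have "cmod (apply_bcontfun w y) \<le> 1 \<and> 0 \<le> Re (apply_bcontfun w y) \<and> \<bar>Im (apply_bcontfun w y)\<bar> \<le> \<eta> \<and>
      ((\<forall>F\<in>H. cmod (apply_bcontfun F y - apply_bcontfun F x) \<le> \<eta> * Re (apply_bcontfun w y))
        \<or> cmod (1 - apply_bcontfun w y) \<le> \<eta>)" for y
  proof -
    define v where "v = (1 - apply_bcontfun f y) / 2"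
    have Re: "Re v = (1 - Re (apply_bcontfun f y)) / 2" by (simp add: v_def)
    have v: "Re v \<ge> 0" "cmod v \<le> 1"
      using complex_Re_le_cmod[of "apply_bcontfun f y"] norm_triangle_ineq4[of 1 "apply_bcontfun f y"] f(2)[of y]
      unfolding Re by (auto simp: v_def norm_divide)
    have "cmod (apply_bcontfun F y - apply_bcontfun F x) \<le> sqrt (2 * K) * sqrt (cmod v)" if "F \<in> H" for F
    proof -
      have "K * (1 - Re (apply_bcontfun f y)) = 2 * K * Re v" by (simp add: Re)
      also have "\<dots> \<le> 2 * K * cmod v"
        using K complex_Re_le_cmod by (intro mult_left_mono) auto
      finally have "(cmod (apply_bcontfun F y - apply_bcontfun F x))\<^sup>2 \<le> 2 * K * cmod v"
        using F[OF that, of y] by simp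
      then show ?thesis
        unfolding real_sqrt_mult[symmetric] by (rule real_le_rsqrt)
    qed
    then show ?thesis
      using dich[OF v] unfolding Let_def w(2)[of y, folded v_def, symmetric]
      by (metis order_trans)
  qed
  moreover have "apply_bcontfun w x = 0"
    by (simp add: w(2) f(3))
  ultimately show ?thesis
    using w(1) Gx by blast
qed

end

section \<open>Evaluation functionals and scalar estimates\<close>

lemma bcontfun_attains_norm:
  fixes f :: "'x::t2_space \<Rightarrow>\<^sub>C 'b::real_normed_vector"
  assumes "compact (UNIV :: 'x set)"
  shows "\<exists>x. norm (apply_bcontfun f x) = norm f"
proof -
  have "continuous_on UNIV (\<lambda>x. norm (apply_bcontfun f x))"
    by (intro continuous_intros continuous_on_apply_bcontfun)
  from continuous_attains_sup[OF assms _ this]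
  obtain x where x: "\<And>y. norm (apply_bcontfun f y) \<le> norm (apply_bcontfun f x)"
    by auto
  then show ?thesis
    by (intro exI[of _ x] antisym norm_bound norm_bounded)
qed

text \<open>
  A Cauchy sequence converges uniformly to some function, and uniform limits of continuous functions are
  continuous over any topological space.
\<close>

lemma complete_closed_bcontfun:
  fixes S :: "('x::topological_space \<Rightarrow>\<^sub>C 'b::complete_space) set"
  assumes "closed S"
  shows "complete S"
proof (rule completeI)
  fix f :: "nat \<Rightarrow> 'x \<Rightarrow>\<^sub>C 'b" assume f: "\<forall>n. f n \<in> S" "Cauchy f"
  have "uniformly_Cauchy_on UNIV (\<lambda>n. apply_bcontfun (f n))"
    using f(2) unfolding Cauchy_def uniformly_Cauchy_on_def by (meson dist_fun_lt_imp_dist_val_lt)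
  then obtain g where "uniform_limit UNIV (\<lambda>n. apply_bcontfun (f n)) g sequentially"
    using Cauchy_uniformly_convergent uniformly_convergent_on_def by blast
  then obtain l where "f \<longlonglongrightarrow> l"
    by (rule uniform_limit_bcontfunE) auto
  then show "\<exists>l\<in>S. f \<longlonglongrightarrow> l"
    using f(1) assms closed_sequentially by blast
qed

lemma evaluation_in_dual_sphere:
  fixes B :: "('x::topological_space \<Rightarrow>\<^sub>C 'k::{real_normed_field, real_inner}) set"
  assumes smul: "\<And>c f y. apply_bcontfun (smul c f) y = c * apply_bcontfun f y"
    and one: "const_bcontfun 1 \<in> B" and c: "norm c = 1"
  shows "(\<lambda>f. c * apply_bcontfun f x) \<in> dual_sphere smul B"
proof -
  have le: "norm (c * apply_bcontfun f x) \<le> 1" if "f \<in> unit_ball B" for f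
    using that norm_bounded[of f x] c by (auto simp: unit_ball_def norm_mult)
  have one': "const_bcontfun 1 \<in> unit_ball B"
    using one by (auto simp: unit_ball_def intro: norm_bound)
  have "dual_norm B (\<lambda>f. c * apply_bcontfun f x) = 1"
    unfolding dual_norm_def
  proof (rule antisym)
    show "(SUP f\<in>unit_ball B. norm (c * apply_bcontfun f x)) \<le> 1"
      using one' le by (intro cSUP_least) auto
    have "norm (c * apply_bcontfun (const_bcontfun 1) x) \<le> (SUP f\<in>unit_ball B. norm (c * apply_bcontfun f x))"
      using le by (intro cSUP_upper[OF one'] bdd_aboveI2)
    then show "1 \<le> (SUP f\<in>unit_ball B. norm (c * apply_bcontfun f x))"
      using c by (simp add: norm_mult)
  qed
  moreover have "bounded ((\<lambda>f. c * apply_bcontfun f x) ` unit_ball B)"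
    using le by (auto simp: bounded_iff)
  ultimately show ?thesis
    by (auto simp: dual_sphere_def dual_space_def linear_map_on_def smul algebra_simps)
qed

lemma unimodular_midpoint:
  fixes \<alpha> :: complex
  assumes "cmod \<alpha> \<le> 1"
  shows "\<exists>t t'. cmod t = 1 \<and> cmod t' = 1 \<and> t + t' = 2 * \<alpha>"
proof -
  define r where "r = cmod \<alpha>"
  define d where "d = sqrt (1 - r\<^sup>2)"
  obtain u where u: "cmod u = 1" "\<alpha> = u * of_real r"
  proof (cases "\<alpha> = 0")
    case True
    then show ?thesis by (intro that[of 1]) (auto simp: r_def)
  next
    case False
    then show ?thesis by (intro that[of "sgn \<alpha>"]) (auto simp: r_def norm_divide sgn_eq)
  qed
  have "r\<^sup>2 \<le> 1" using assms by (simp add: r_def power_le_one)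
  then have "r\<^sup>2 + d\<^sup>2 = 1" by (simp add: d_def)
  then have "cmod (Complex r d) = 1" "cmod (Complex r (- d)) = 1"
    by (simp_all add: cmod_def)
  then have "cmod (u * Complex r d) = 1" "cmod (u * Complex r (- d)) = 1"
    using u(1) by (simp_all add: norm_mult)
  moreover have "u * Complex r d + u * Complex r (- d) = 2 * \<alpha>"
    by (simp add: u(2) complex_eq_iff)
  ultimately show ?thesis by blast
qed

text \<open>
  Let \<open>\<alpha>\<close> be the value of a real function at a point \<open>y\<close>, \<open>c\<close> its value at the peak, and \<open>1 - \<rho>\<close> the value at
  \<open>y\<close> of the bump. Adding \<open>1 - c\<close> times the bump lifts the value at the peak to \<open>1\<close>. Since the lift equals
  \<open>1 + (\<alpha> - c) - (1 - c) * \<rho>\<close> and \<open>1 - c \<ge> \<eta>\<close>, it does not exceed \<open>1\<close> where \<open>\<alpha> - c\<close> is small compared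
  with \<open>\<rho>\<close>; elsewhere the bump is too small to matter. The bound is exactly \<open>1\<close>, so that the lifted
  function lies on the unit sphere.
\<close>

lemma pushed_to_face_bound:
  fixes \<alpha> c \<rho> \<eta> :: real
  assumes "0 \<le> \<eta>" "0 \<le> \<rho>" "\<rho> \<le> 1" "\<bar>\<alpha>\<bar> \<le> 1 - \<eta>" "\<bar>c\<bar> \<le> 1 - \<eta>"
    and "\<bar>\<alpha> - c\<bar> \<le> \<eta> * \<rho> \<or> 1 - \<rho> \<le> \<eta> / 2"
  shows "\<bar>\<alpha> + (1 - c) * (1 - \<rho>)\<bar> \<le> 1"
proof -
  have eta: "0 \<le> (1 - c) * (1 - \<rho>)" "0 \<le> 1 - c"
    using assms by (auto intro!: mult_nonneg_nonneg)
  have "\<alpha> + (1 - c) * (1 - \<rho>) \<le> 1"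
    using assms(6)
  proof
    assume "\<bar>\<alpha> - c\<bar> \<le> \<eta> * \<rho>"
    also have "\<eta> * \<rho> \<le> (1 - c) * \<rho>"
      using assms by (intro mult_right_mono) auto
    finally show ?thesis by (simp add: algebra_simps)
  next
    assume "1 - \<rho> \<le> \<eta> / 2"
    then have "(1 - c) * (1 - \<rho>) \<le> 2 * (\<eta> / 2)"
      using assms eta by (intro mult_mono) auto
    then show ?thesis using assms by auto
  qed
  then show ?thesis using assms(1-4) eta(1) by linarith
qed

section \<open>Lushness\<close>

context unif_alg
begin

definition "ReA = closure (Re_bcontfun ` A)"

lemma Re_in_ReA:
  assumes "f \<in> A"
  shows "Re_bcontfun f \<in> ReA"
  unfolding ReA_def by (rule subsetD[OF closure_subset imageI[OF assms]])

lemma ReA_approx: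
  assumes "a \<in> ReA" "e > 0"
  shows "\<exists>F\<in>A. norm (Re_bcontfun F - a) \<le> e"
proof -
  have "\<exists>y\<in>Re_bcontfun ` A. dist y a < e"
    using assms unfolding ReA_def closure_approachable by blast
  then obtain F where "F \<in> A" "norm (Re_bcontfun F - a) < e"
    unfolding dist_norm by blast
  then show ?thesis
    by (intro bexI[of _ F] less_imp_le)
qed

lemma ReA_const: "const_bcontfun r \<in> ReA"
proof -
  have eq: "const_bcontfun r = (Re_bcontfun (const_bcontfun (of_real r)) :: 'x \<Rightarrow>\<^sub>C real)"
    by (rule bcontfun_eqI) (simp only: rep_eqs(3) const_bcontfun.rep_eq Re_complex_of_real)
  show ?thesis
    by (subst eq) (rule Re_in_ReA[OF A_const])
qed

lemma subspace_ReA: "subspace ReA"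
proof -
  have image: "\<exists>h\<in>A. Re_bcontfun h = r *\<^sub>R Re_bcontfun f + Re_bcontfun g" if "f \<in> A" "g \<in> A" for r f g
    by (rule bexI[of _ "scaleC_bcontfun (of_real r) f + g"])
      (use that in \<open>auto intro!: bcontfun_eqI A_add A_scale simp: rep_eqs\<close>)
  have comb: "r *\<^sub>R a + b \<in> ReA" if ab: "a \<in> ReA" "b \<in> ReA" for r a b
    unfolding ReA_def closure_approachable
  proof (intro allI impI)
    fix e :: real assume e: "e > 0"
    define d where "d = e / (\<bar>r\<bar> + 2)"
    have d: "d > 0" "(\<bar>r\<bar> + 1) * d < e" using e by (auto simp: d_def field_simps)
    obtain f g where fg: "f \<in> A" "norm (Re_bcontfun f - a) \<le> d" "g \<in> A" "norm (Re_bcontfun g - b) \<le> d"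
      using ReA_approx[OF ab(1) d(1)] ReA_approx[OF ab(2) d(1)] by blast
    have "norm (r *\<^sub>R Re_bcontfun f + Re_bcontfun g - (r *\<^sub>R a + b))
        \<le> norm (r *\<^sub>R (Re_bcontfun f - a)) + norm (Re_bcontfun g - b)"
      using norm_triangle_ineq[of "r *\<^sub>R (Re_bcontfun f - a)" "Re_bcontfun g - b"] by (simp add: algebra_simps)
    also have "\<dots> \<le> \<bar>r\<bar> * d + d"
      using fg by (auto intro!: add_mono mult_left_mono)
    also have "\<dots> < e" using d(2) by (simp add: algebra_simps)
    finally have less: "norm (r *\<^sub>R Re_bcontfun f + Re_bcontfun g - (r *\<^sub>R a + b)) < e" .
    obtain h where "h \<in> A" "Re_bcontfun h = r *\<^sub>R Re_bcontfun f + Re_bcontfun g"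
      using image[OF fg(1,3)] by blast
    then show "\<exists>y\<in>Re_bcontfun ` A. dist y (r *\<^sub>R a + b) < e"
      using less by (metis dist_norm imageI)
  qed
  have zero: "0 \<in> ReA"
    using ReA_const[of 0] by simp
  show ?thesis
  proof (rule subspaceI)
    fix a b assume "a \<in> ReA" "b \<in> ReA"
    then show "a + b \<in> ReA" using comb[of a b 1] by simp
  next
    fix r a assume "a \<in> ReA"
    then show "r *\<^sub>R a \<in> ReA" using comb[OF _ zero, of a r] by simp
  qed (rule zero)
qed

text \<open>
  The functions \<open>u\<close> and \<open>v\<close> lie in the opposite faces of the unit sphere on which evaluation at \<open>x\<close> is
  \<open>1\<close> and \<open>- 1\<close>; their distances from \<open>a\<close> are, up to \<open>\<epsilon>\<close>, the least possible ones. They are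
  \<open>f + (1 - c) U\<close> and \<open>f - (1 + c) U\<close>, where \<open>f\<close> is a real part close to \<open>a\<close>, \<open>c = f x\<close> and \<open>U\<close> is the
  real part of a bump function at \<open>x\<close>. The point \<open>x\<close> can be the same for finitely many \<open>a\<close> and such
  that \<open>k\<close> almost attains its maximum there.
\<close>

lemma ReA_near_faces:
  assumes S: "finite S" "\<And>a. a \<in> S \<Longrightarrow> a \<in> ReA \<and> norm a \<le> 1" and k: "k \<in> ReA" and eps: "\<epsilon> > 0"
  shows "\<exists>x. (\<forall>a\<in>S. \<exists>u\<in>ReA. \<exists>v\<in>ReA. norm u \<le> 1 \<and> norm v \<le> 1 \<and>
      apply_bcontfun u x = 1 \<and> apply_bcontfun v x = - 1 \<and>
      norm (a - u) \<le> 1 - apply_bcontfun a x + \<epsilon> \<and> norm (a - v) \<le> 1 + apply_bcontfun a x + \<epsilon> \<and>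
      (\<exists>z\<in>closed_segment u v. norm (a - z) \<le> \<epsilon>)) \<and>
    (\<forall>y. apply_bcontfun k y \<le> apply_bcontfun k x + \<epsilon>)"
proof -
  define \<eta> where "\<eta> = min (1/4) (\<epsilon> / 6)"
  have eta: "\<eta> > 0" "\<eta> \<le> 1/4" "6 * \<eta> \<le> \<epsilon>"
    using eps by (simp_all add: \<eta>_def)
  \<comment> \<open>Shrinking \<open>a\<close> first leaves room: the approximating real parts have norm at most \<open>1 - \<eta>\<close>.\<close>
  have "\<exists>F\<in>A. norm (Re_bcontfun F - (1 - 2 * \<eta>) *\<^sub>R a) \<le> \<eta>" if "a \<in> S" for a
    using ReA_approx[OF subspace_scale[OF subspace_ReA] eta(1)] S(2)[OF that] by blast
  then obtain F where F: "\<And>a. a \<in> S \<Longrightarrow> F a \<in> A" "\<And>a. a \<in> S \<Longrightarrow> norm (Re_bcontfun (F a) - (1 - 2 * \<eta>) *\<^sub>R a) \<le> \<eta>"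
    by metis
  obtain G where G: "G \<in> A" "norm (Re_bcontfun G - k) \<le> \<eta>"
    using ReA_approx[OF k eta(1)] by blast
  have H: "finite (F ` S)" "F ` S \<subseteq> A" "\<eta> / 2 > 0" using S F eta by auto
  obtain x w where w: "w \<in> A" "apply_bcontfun w x = 0"
    and w1: "\<And>y. cmod (apply_bcontfun w y) \<le> 1" and w0: "\<And>y. 0 \<le> Re (apply_bcontfun w y)"
    and dich: "\<And>y. (\<forall>f\<in>F ` S. cmod (apply_bcontfun f y - apply_bcontfun f x) \<le> \<eta> / 2 * Re (apply_bcontfun w y))
        \<or> cmod (1 - apply_bcontfun w y) \<le> \<eta> / 2"
    and Gx: "\<And>y. Re (apply_bcontfun G y) \<le> Re (apply_bcontfun G x) + \<eta> / 2"
    using sector_peaking_function[OF H(1,2) G(1) H(3)] by blast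
  define U where "U = const_bcontfun 1 - Re_bcontfun w"
  have U: "apply_bcontfun U y = 1 - Re (apply_bcontfun w y)" for y
    by (simp add: U_def rep_eqs)
  have UB: "U \<in> ReA"
    unfolding U_def by (intro subspace_diff subspace_ReA ReA_const Re_in_ReA w)
  have Rew1: "Re (apply_bcontfun w y) \<le> 1" for y
    using complex_Re_le_cmod w1 by (rule order_trans)
  have "norm U \<le> 1"
    using w0 Rew1 by (intro norm_bound) (auto simp: U)
  show ?thesis
  proof (intro exI[of _ x] conjI ballI)
    fix a assume a: "a \<in> S"
    define f where "f = Re_bcontfun (F a)"
    define c where "c = apply_bcontfun f x"
    define u where "u = f + (1 - c) *\<^sub>R U"
    define v where "v = f - (1 + c) *\<^sub>R U"
    have fB: "f \<in> ReA" unfolding f_def by (intro Re_in_ReA F a)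
    have "norm f \<le> norm (f - (1 - 2 * \<eta>) *\<^sub>R a) + norm ((1 - 2 * \<eta>) *\<^sub>R a)"
      using norm_triangle_ineq[of "f - (1 - 2 * \<eta>) *\<^sub>R a" "(1 - 2 * \<eta>) *\<^sub>R a"] by simp
    also have "\<dots> \<le> \<eta> + (1 - 2 * \<eta>)"
      using F(2)[OF a] S(2)[OF a] eta by (intro add_mono) (auto simp: f_def mult_left_le)
    finally have nf: "norm f \<le> 1 - \<eta>" by simp
    have "a - f = (2 * \<eta>) *\<^sub>R a - (f - (1 - 2 * \<eta>) *\<^sub>R a)"
      by (simp add: algebra_simps)
    then have "norm (a - f) \<le> norm ((2 * \<eta>) *\<^sub>R a) + norm (f - (1 - 2 * \<eta>) *\<^sub>R a)"
      by (metis norm_triangle_ineq4)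
    also have "\<dots> \<le> 2 * \<eta> + \<eta>"
      using F(2)[OF a] S(2)[OF a] eta by (intro add_mono) (auto simp: f_def mult_left_le)
    finally have af: "norm (a - f) \<le> 3 * \<eta>" by simp
    have fy: "\<bar>apply_bcontfun f y\<bar> \<le> 1 - \<eta>" for y
      using norm_bounded[of f y] nf by simp
    then have c: "\<bar>c\<bar> \<le> 1 - \<eta>" by (simp add: c_def)
    have ac: "\<bar>apply_bcontfun a x - c\<bar> \<le> 3 * \<eta>"
      using norm_bounded[of "a - f" x] af by (simp add: c_def)
    have close: "\<bar>apply_bcontfun f y - c\<bar> \<le> \<eta> * Re (apply_bcontfun w y) \<or> 1 - Re (apply_bcontfun w y) \<le> \<eta> / 2" for y
      using dich[of y]
    proof
      assume "\<forall>f\<in>F ` S. cmod (apply_bcontfun f y - apply_bcontfun f x) \<le> \<eta> / 2 * Re (apply_bcontfun w y)"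
      then have "cmod (apply_bcontfun (F a) y - apply_bcontfun (F a) x) \<le> \<eta> / 2 * Re (apply_bcontfun w y)"
        using a by blast
      moreover have "\<bar>apply_bcontfun f y - c\<bar> \<le> cmod (apply_bcontfun (F a) y - apply_bcontfun (F a) x)"
        using abs_Re_le_cmod[of "apply_bcontfun (F a) y - apply_bcontfun (F a) x"] by (simp add: f_def c_def rep_eqs)
      moreover have "\<eta> / 2 * Re (apply_bcontfun w y) \<le> \<eta> * Re (apply_bcontfun w y)"
        using w0 eta by (intro mult_right_mono) auto
      ultimately show ?thesis by linarith
    next
      assume "cmod (1 - apply_bcontfun w y) \<le> \<eta> / 2"
      then show ?thesis using complex_Re_le_cmod[of "1 - apply_bcontfun w y"] by simp
    qed
    have "\<bar>apply_bcontfun u y\<bar> \<le> 1" for y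
      using pushed_to_face_bound[OF less_imp_le[OF eta(1)] w0 Rew1 fy c close] by (simp add: u_def U)
    then have u1: "norm u \<le> 1" by (intro norm_bound) simp
    have "\<bar>apply_bcontfun v y\<bar> \<le> 1" for y
    proof -
      have "\<bar>- apply_bcontfun f y + (1 - (- c)) * (1 - Re (apply_bcontfun w y))\<bar> \<le> 1"
        by (rule pushed_to_face_bound[OF less_imp_le[OF eta(1)] w0 Rew1]) (use fy c close[of y] in \<open>auto simp: abs_minus_commute\<close>)
      then show ?thesis
        by (simp add: v_def U abs_le_iff)
    qed
    then have v1: "norm v \<le> 1" by (intro norm_bound) simp
    have "norm (f - u) \<le> 1 - c"
      using \<open>norm U \<le> 1\<close> c eta by (simp add: u_def mult_left_le)
    then have au: "norm (a - u) \<le> 1 - apply_bcontfun a x + \<epsilon>"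
      using norm_triangle_ineq[of "a - f" "f - u"] af ac eta(3) by (simp add: abs_le_iff)
    have "norm (f - v) \<le> 1 + c"
      using \<open>norm U \<le> 1\<close> c eta by (simp add: v_def mult_left_le)
    then have av: "norm (a - v) \<le> 1 + apply_bcontfun a x + \<epsilon>"
      using norm_triangle_ineq[of "a - f" "f - v"] af ac eta(3) by (simp add: abs_le_iff)
    have "f \<in> closed_segment u v"
    proof -
      have "f = (1 - (1 - c) / 2) *\<^sub>R u + ((1 - c) / 2) *\<^sub>R v"
        by (rule bcontfun_eqI) (simp add: u_def v_def field_simps)
      then show ?thesis
        unfolding closed_segment_def using c eta by (intro CollectI exI[of _ "(1 - c) / 2"]) auto
    qed
    then have "\<exists>z\<in>closed_segment u v. norm (a - z) \<le> \<epsilon>"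
      using af eta by (intro bexI[of _ f]) auto
    moreover have "u \<in> ReA" "v \<in> ReA"
      unfolding u_def v_def by (intro subspace_add subspace_diff subspace_scale subspace_ReA fB UB)+
    moreover have "apply_bcontfun u x = 1" "apply_bcontfun v x = - 1"
      by (simp_all add: u_def v_def U w(2) flip: c_def)
    ultimately show "\<exists>u\<in>ReA. \<exists>v\<in>ReA. norm u \<le> 1 \<and> norm v \<le> 1 \<and>
      apply_bcontfun u x = 1 \<and> apply_bcontfun v x = - 1 \<and>
      norm (a - u) \<le> 1 - apply_bcontfun a x + \<epsilon> \<and> norm (a - v) \<le> 1 + apply_bcontfun a x + \<epsilon> \<and>
      (\<exists>z\<in>closed_segment u v. norm (a - z) \<le> \<epsilon>)"
      using u1 v1 au av by blast
  next
    have "\<bar>Re (apply_bcontfun G y) - apply_bcontfun k y\<bar> \<le> \<eta>" for y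
      using norm_bounded[of "Re_bcontfun G - k" y] G(2) by (simp add: rep_eqs)
    then show "\<forall>y. apply_bcontfun k y \<le> apply_bcontfun k x + \<epsilon>"
      using Gx eta by (smt (verit) field_sum_of_halves)
  qed
qed

lemma banach_over_A: "banach_over scaleC_bcontfun A"
  unfolding banach_over_def
proof (rule conjI[OF _ conjI])
  show "normed_space_over (scaleC_bcontfun :: complex \<Rightarrow> ('x \<Rightarrow>\<^sub>C complex) \<Rightarrow> _)"
    by (rule normed_space_over_scaleC)
  show "module.subspace scaleC_bcontfun A"
    by (rule subspace_A)
  show "complete A"
    by (rule complete_closed_bcontfun[OF closed_A])
qed

lemma banach_over_ReA: "banach_over scaleR ReA"
  unfolding banach_over_def
proof (rule conjI[OF _ conjI])
  show "normed_space_over (scaleR :: real \<Rightarrow> ('x \<Rightarrow>\<^sub>C real) \<Rightarrow> _)"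
    by (rule normed_space_over_scaleR)
  show "module.subspace scaleR ReA"
    using subspace_ReA unfolding subspace_raw_def .
  show "complete ReA"
    by (rule complete_closed_bcontfun) (simp add: ReA_def)
qed

text \<open>
  Let \<open>b\<close> attain its norm with value \<open>l\<close>, and let \<open>x\<close> be a peak at which \<open>cnj l * b\<close> is almost \<open>1\<close> and around
  which \<open>a\<close> is almost constant, with value \<open>\<alpha>\<close>. Write \<open>\<alpha>\<close> as the midpoint of two unimodular numbers
  \<open>t\<close>. Replacing \<open>\<alpha>\<close> by \<open>t\<close> near \<open>x\<close>, that is, adding \<open>(t - \<alpha>) (1 - w)\<close> to \<open>a\<close>, gives functions of norm at
  most \<open>1 + 4 \<eta>\<close> with the exact value \<open>t\<close> at \<open>x\<close>, whose midpoint is \<open>a\<close>.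
\<close>

lemma lush_A: "lush scaleC_bcontfun A"
  unfolding lush_def
proof (intro conjI banach_over_A ballI allI impI)
  fix a b :: "'x \<Rightarrow>\<^sub>C complex" and \<epsilon> :: real
  assume a: "a \<in> unit_sphere A" and b: "b \<in> unit_sphere A" and eps: "\<epsilon> > 0"
  define \<eta> where "\<eta> = \<epsilon> / 8"
  have eta: "\<eta> > 0" "4 * \<eta> < \<epsilon>" using eps by (auto simp: \<eta>_def)
  obtain x0 where x0: "cmod (apply_bcontfun b x0) = 1"
    using bcontfun_attains_norm[OF compact_UNIV, of b] b by (auto simp: unit_sphere_def)
  define l where "l = apply_bcontfun b x0"
  have l: "cmod l = 1" "cnj l * l = 1" "l * cnj l = 1"
    using x0 complex_norm_square[of l] by (auto simp: l_def mult.commute)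
  have aA: "a \<in> A" "norm a = 1" and bA: "b \<in> A" "norm b = 1"
    using a b by (auto simp: unit_sphere_def)
  obtain x w where w: "w \<in> A" "apply_bcontfun w x = 0"
    and w1: "\<And>y. cmod (apply_bcontfun w y) \<le> 1" and w0: "\<And>y. 0 \<le> Re (apply_bcontfun w y)"
    and wI: "\<And>y. \<bar>Im (apply_bcontfun w y)\<bar> \<le> \<eta>"
    and dich: "\<And>y. cmod (apply_bcontfun a y - apply_bcontfun a x) \<le> \<eta> * Re (apply_bcontfun w y)
        \<or> cmod (1 - apply_bcontfun w y) \<le> \<eta>"
    and Gx: "\<And>y. Re (cnj l * apply_bcontfun b y) \<le> Re (cnj l * apply_bcontfun b x) + \<eta>"
    using sector_peaking_function[of "{a}" "scaleC_bcontfun (cnj l) b", OF _ _ A_scale[OF bA(1)] eta(1)] aA(1)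
    by (auto simp: rep_eqs simp del: complex_cnj_cnj times_complex.sel)
  define q where "q f = cnj l * apply_bcontfun f x" for f
  have q: "q \<in> dual_sphere scaleC_bcontfun A"
    using evaluation_in_dual_sphere[of scaleC_bcontfun A "cnj l" x] A_const l
    unfolding q_def[abs_def] by (simp add: rep_eqs)
  have "Re (q b) \<ge> 1 - \<eta>"
    using Gx[of x0] l(2) by (simp add: q_def flip: l_def)
  then have bq: "b \<in> slice A q \<epsilon>"
    using bA eta by (auto simp: slice_def unit_ball_def inner_one_complex)
  define \<alpha> where "\<alpha> = apply_bcontfun a x"
  have \<alpha>: "cmod \<alpha> \<le> 1" using norm_bounded[of a x] aA by (simp add: \<alpha>_def)
  obtain t t' where t: "cmod t = 1" "cmod t' = 1" "t + t' = 2 * \<alpha>"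
    using unimodular_midpoint[OF \<alpha>] by blast
  define f where "f t = a + scaleC_bcontfun (t - \<alpha>) (const_bcontfun 1 - w)" for t
  have f: "apply_bcontfun (f t) y = apply_bcontfun a y + (t - \<alpha>) * (1 - apply_bcontfun w y)" for t y
    by (simp add: f_def rep_eqs)
  have fA: "f t \<in> A" for t
    unfolding f_def by (intro A_add A_scale A_diff A_const aA w)
  have nf: "norm (f t) \<le> 1 + 4 * \<eta>" if t: "cmod t = 1" for t
  proof (rule norm_bound)
    fix y
    let ?a = "apply_bcontfun a y" and ?w = "apply_bcontfun w y"
    have ay: "cmod ?a \<le> 1" using norm_bounded[of a y] aA by simp
    have Rew1: "Re ?w \<le> 1" using complex_Re_le_cmod[of ?w] w1[of y] by linarith
    have "cmod ?w \<le> Re ?w + \<eta>" "cmod (1 - ?w) \<le> (1 - Re ?w) + \<eta>"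
      using cmod_le[of ?w] cmod_le[of "1 - ?w"] w0[of y] wI[of y] Rew1 by auto
    moreover have "cmod (?a * ?w + t * (1 - ?w)) \<le> cmod ?w + cmod (1 - ?w)"
      using norm_triangle_ineq[of "?a * ?w" "t * (1 - ?w)"] t mult_right_mono[OF ay norm_ge_zero[of ?w]]
      by (simp add: norm_mult)
    moreover have "cmod ((?a - \<alpha>) * (1 - ?w)) \<le> 2 * \<eta>"
      using dich[of y]
    proof
      assume "cmod (?a - apply_bcontfun a x) \<le> \<eta> * Re ?w"
      then have "cmod (?a - \<alpha>) \<le> \<eta>"
        using mult_left_le[OF Rew1, of \<eta>] eta unfolding \<alpha>_def by linarith
      moreover have "cmod (1 - ?w) \<le> 2"
        using norm_triangle_ineq4[of 1 ?w] w1[of y] by simp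
      ultimately have "cmod (?a - \<alpha>) * cmod (1 - ?w) \<le> \<eta> * 2"
        using eta by (intro mult_mono) auto
      then show ?thesis by (simp add: norm_mult)
    next
      assume "cmod (1 - ?w) \<le> \<eta>"
      moreover have "cmod (?a - \<alpha>) \<le> 2"
        using norm_triangle_ineq4[of ?a \<alpha>] ay \<alpha> by simp
      ultimately have "cmod (?a - \<alpha>) * cmod (1 - ?w) \<le> 2 * \<eta>"
        using eta by (intro mult_mono) auto
      then show ?thesis by (simp add: norm_mult)
    qed
    \<comment> \<open>An almost convex combination of \<open>a\<close> and \<open>t\<close>, and an error where \<open>a\<close> differs from \<open>\<alpha>\<close>.\<close>
    moreover have "apply_bcontfun (f t) y = (?a * ?w + t * (1 - ?w)) + (?a - \<alpha>) * (1 - ?w)"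
      by (simp add: f algebra_simps)
    then have "cmod (apply_bcontfun (f t) y) \<le> cmod (?a * ?w + t * (1 - ?w)) + cmod ((?a - \<alpha>) * (1 - ?w))"
      by (metis norm_triangle_ineq)
    ultimately show "cmod (apply_bcontfun (f t) y) \<le> 1 + 4 * \<eta>" by linarith
  qed
  define r where "r = 1 / (1 + 4 * \<eta>)"
  have r: "0 < r" "r * (1 + 4 * \<eta>) = 1" "1 - r \<le> 4 * \<eta>" "r \<le> 1"
    using eta by (auto simp: r_def field_simps)
  have hull: "r *\<^sub>R f t \<in> torus_mult scaleC_bcontfun (slice A q \<epsilon>)" if t: "cmod t = 1" for t
  proof -
    have tt: "t * cnj t = 1" using t complex_norm_square[of t] by simp
    define h where "h = scaleC_bcontfun (of_real r * l * cnj t) (f t)"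
    have "norm h = cmod (of_real r * l * cnj t) * norm (f t)"
      unfolding h_def by (rule normed_space_over.norm_smul[OF normed_space_over_scaleC])
    also have "\<dots> = r * norm (f t)"
      using t l r by (simp add: norm_mult)
    also have "\<dots> \<le> r * (1 + 4 * \<eta>)"
      using nf[OF t] r by (intro mult_left_mono) auto
    finally have "norm h \<le> 1" using r by simp
    moreover have "h \<in> A" unfolding h_def by (intro A_scale fA)
    moreover have "q h = of_real r * (cnj l * l) * (t * cnj t)"
      by (simp add: q_def h_def rep_eqs f w(2) \<alpha>_def mult_ac)
    then have "q h = of_real r" using l tt by simp
    ultimately have "h \<in> slice A q \<epsilon>"
      using r eta by (simp add: slice_def unit_ball_def inner_one_complex)
    moreover have "r *\<^sub>R f t = scaleC_bcontfun (t * cnj l) h"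
    proof (rule bcontfun_eqI)
      fix y
      have "t * cnj l * (of_real r * l * cnj t * apply_bcontfun (f t) y)
          = (t * cnj t) * (cnj l * l) * (of_real r * apply_bcontfun (f t) y)"
        by (simp only: mult_ac)
      then show "apply_bcontfun (r *\<^sub>R f t) y = apply_bcontfun (scaleC_bcontfun (t * cnj l) h) y"
        using tt l by (simp add: h_def rep_eqs scaleR_conv_of_real)
    qed
    moreover have "cmod (t * cnj l) = 1" using t l by (simp add: norm_mult)
    ultimately show ?thesis unfolding torus_mult_def by blast
  qed
  have "r *\<^sub>R a = (1/2) *\<^sub>R (r *\<^sub>R f t) + (1/2) *\<^sub>R (r *\<^sub>R f t')"
  proof (rule bcontfun_eqI)
    fix y
    have "apply_bcontfun (f t) y + apply_bcontfun (f t') y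
        = 2 * apply_bcontfun a y + (t + t' - 2 * \<alpha>) * (1 - apply_bcontfun w y)"
      by (simp add: f algebra_simps)
    then have "apply_bcontfun (f t) y + apply_bcontfun (f t') y = 2 * apply_bcontfun a y"
      using t(3) by simp
    moreover have "apply_bcontfun ((1/2) *\<^sub>R (r *\<^sub>R f t) + (1/2) *\<^sub>R (r *\<^sub>R f t')) y
        = of_real (r / 2) * (apply_bcontfun (f t) y + apply_bcontfun (f t') y)"
      by (simp add: scaleR_conv_of_real distrib_left)
    ultimately show "apply_bcontfun (r *\<^sub>R a) y = apply_bcontfun ((1/2) *\<^sub>R (r *\<^sub>R f t) + (1/2) *\<^sub>R (r *\<^sub>R f t')) y"
      by (simp add: scaleR_conv_of_real)
  qed
  also have "\<dots> \<in> convex hull (torus_mult scaleC_bcontfun (slice A q \<epsilon>))"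
    by (intro convexD[OF convex_convex_hull] hull_inc hull t) auto
  finally have "infdist a (convex hull (torus_mult scaleC_bcontfun (slice A q \<epsilon>))) \<le> dist a (r *\<^sub>R a)"
    by (rule infdist_le)
  also have "dist a (r *\<^sub>R a) = norm ((1 - r) *\<^sub>R a)"
    by (simp add: dist_norm algebra_simps)
  also have "\<dots> < \<epsilon>" using r eta aA by simp
  finally show "\<exists>q\<in>dual_sphere scaleC_bcontfun A. b \<in> slice A q \<epsilon> \<and>
      infdist a (convex hull (torus_mult scaleC_bcontfun (slice A q \<epsilon>))) < \<epsilon>"
    using q bq by blast
qed

text \<open>
  The functional is evaluation at the point \<open>x\<close> provided by \<open>ReA_near_faces\<close>, up to sign; \<open>a\<close> is close to a
  segment between the two opposite faces at \<open>x\<close>, both of which lie in the slice up to sign.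
\<close>

lemma lush_ReA: "lush scaleR ReA"
  unfolding lush_def
proof (intro conjI banach_over_ReA ballI allI impI)
  fix a b :: "'x \<Rightarrow>\<^sub>C real" and \<epsilon> :: real
  assume a: "a \<in> unit_sphere ReA" and b: "b \<in> unit_sphere ReA" and eps: "\<epsilon> > 0"
  have aB: "a \<in> ReA" "norm a = 1" and bB: "b \<in> ReA" "norm b = 1"
    using a b by (auto simp: unit_sphere_def)
  obtain x0 where x0: "\<bar>apply_bcontfun b x0\<bar> = 1"
    using bcontfun_attains_norm[OF compact_UNIV, of b] bB by auto
  define l where "l = apply_bcontfun b x0"
  have l: "l * l = 1" "\<bar>l\<bar> = 1"
    using x0 by (auto simp: l_def abs_if split: if_splits)
  obtain x u v z where u: "u \<in> ReA" "norm u \<le> 1" "apply_bcontfun u x = 1"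
    and v: "v \<in> ReA" "norm v \<le> 1" "apply_bcontfun v x = - 1"
    and z: "z \<in> closed_segment u v" "norm (a - z) \<le> \<epsilon> / 2"
    and kx: "\<And>y. apply_bcontfun (l *\<^sub>R b) y \<le> apply_bcontfun (l *\<^sub>R b) x + \<epsilon> / 2"
    using ReA_near_faces[of "{a}" "l *\<^sub>R b" "\<epsilon> / 2"] aB subspace_scale[OF subspace_ReA bB(1), of l] eps by auto
  define q where "q f = l * apply_bcontfun f x" for f
  have q: "q \<in> dual_sphere scaleR ReA"
    using evaluation_in_dual_sphere[of scaleR ReA l x] ReA_const l
    unfolding q_def[abs_def] by simp
  have bq: "b \<in> slice ReA q \<epsilon>"
    using kx[of x0] l eps bB by (simp add: slice_def unit_ball_def q_def flip: l_def)
  have "u \<in> torus_mult scaleR (slice ReA q \<epsilon>)"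
  proof -
    have "l *\<^sub>R u \<in> slice ReA q \<epsilon>"
      using u l eps subspace_scale[OF subspace_ReA u(1), of l] by (simp add: slice_def unit_ball_def q_def)
    then show ?thesis
      unfolding torus_mult_def using l by (intro CollectI exI[of _ l] exI[of _ "l *\<^sub>R u"]) auto
  qed
  moreover have "v \<in> torus_mult scaleR (slice ReA q \<epsilon>)"
  proof -
    have "(- l) *\<^sub>R v \<in> slice ReA q \<epsilon>"
      using v l eps subspace_scale[OF subspace_ReA v(1), of "- l"]
      by (simp add: slice_def unit_ball_def q_def flip: mult.assoc)
    then show ?thesis
      unfolding torus_mult_def using l by (intro CollectI exI[of _ "- l"] exI[of _ "(- l) *\<^sub>R v"]) auto
  qed
  ultimately have "closed_segment u v \<subseteq> convex hull (torus_mult scaleR (slice ReA q \<epsilon>))"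
    by (intro closed_segment_subset convex_convex_hull hull_inc)
  then have "infdist a (convex hull (torus_mult scaleR (slice ReA q \<epsilon>))) \<le> dist a z"
    using z(1) by (intro infdist_le) auto
  also have "\<dots> < \<epsilon>" using z(2) eps by (simp add: dist_norm)
  finally show "\<exists>q\<in>dual_sphere scaleR ReA. b \<in> slice ReA q \<epsilon> \<and>
      infdist a (convex hull (torus_mult scaleR (slice ReA q \<epsilon>))) < \<epsilon>"
    using q bq by blast
qed

end

section \<open>Extension of isometries\<close>

text \<open>
  The isometry condition for finite linear combinations can be checked by functionals, and only
  finitely many vectors occur in it. Suppose that for any finitely many vectors of \<open>B\<close> there are
  contractive functionals \<open>f\<close>, \<open>g\<close> on the two spaces that almost agree along \<open>E\<close> on these vectors and almost
  norm a prescribed vector \<open>k\<close> of \<open>B\<close>. Taking for \<open>k\<close> a combination of vectors \<open>b\<close> bounds its norm by that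
  of the combination of the vectors \<open>E b\<close>; taking for \<open>k\<close> a preimage of the latter combination gives the
  converse. Additivity, homogeneity and isometry are all instances with three vectors.
\<close>

lemma linear_isometry_if_jointly_normed:
  fixes B :: "'v::real_normed_vector set" and E :: "'v \<Rightarrow> 'w::real_normed_vector"
  assumes B: "subspace B" and E: "\<And>b. b \<in> B \<Longrightarrow> norm (E b) = norm b" "E ` B = UNIV"
    and approx: "\<And>S k \<epsilon>. finite S \<Longrightarrow> S \<subseteq> B \<Longrightarrow> k \<in> B \<Longrightarrow> \<epsilon> > 0 \<Longrightarrow>
      \<exists>(f :: 'w \<Rightarrow> real) (g :: 'v \<Rightarrow> real). linear f \<and> (\<forall>y. \<bar>f y\<bar> \<le> norm y) \<and> linear g \<and> (\<forall>b. \<bar>g b\<bar> \<le> norm b) \<and>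
        (\<forall>b\<in>S. \<bar>f (E b) - g b\<bar> \<le> \<epsilon>) \<and> norm k \<le> \<bar>g k\<bar> + \<epsilon>"
  shows "linear_map_on scaleR scaleR B E \<and> surj_isometry B UNIV E"
proof -
  have comb: "norm (c1 *\<^sub>R E b1 + c2 *\<^sub>R E b2 + c3 *\<^sub>R E b3) = norm (c1 *\<^sub>R b1 + c2 *\<^sub>R b2 + c3 *\<^sub>R b3)"
    if b: "b1 \<in> B" "b2 \<in> B" "b3 \<in> B" for c1 c2 c3 b1 b2 b3
  proof -
    define b where "b = c1 *\<^sub>R b1 + c2 *\<^sub>R b2 + c3 *\<^sub>R b3"
    define v where "v = c1 *\<^sub>R E b1 + c2 *\<^sub>R E b2 + c3 *\<^sub>R E b3"
    define M where "M = \<bar>c1\<bar> + \<bar>c2\<bar> + \<bar>c3\<bar>"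
    have bB: "b \<in> B"
      unfolding b_def using b by (intro subspace_add[OF B] subspace_scale[OF B])
    obtain k where k: "k \<in> B" "E k = v" using E(2) by (metis UNIV_I imageE)
    have close: "\<bar>f v - g b\<bar> \<le> M * \<epsilon>"
      if f: "linear f" and g: "linear g" and fg: "\<forall>b\<in>{b1, b2, b3, k}. \<bar>f (E b) - g b\<bar> \<le> \<epsilon>"
      for f :: "'w \<Rightarrow> real" and g :: "'v \<Rightarrow> real" and \<epsilon>
    proof -
      have "f v - g b = c1 * (f (E b1) - g b1) + c2 * (f (E b2) - g b2) + c3 * (f (E b3) - g b3)"
        by (simp add: v_def b_def linear_add[OF f] linear_add[OF g] linear_cmul[OF f] linear_cmul[OF g] algebra_simps)
      also have "\<bar>\<dots>\<bar> \<le> \<bar>c1\<bar> * \<bar>f (E b1) - g b1\<bar> + \<bar>c2\<bar> * \<bar>f (E b2) - g b2\<bar> + \<bar>c3\<bar> * \<bar>f (E b3) - g b3\<bar>"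
        unfolding abs_mult[symmetric] by linarith
      also have "\<dots> \<le> \<bar>c1\<bar> * \<epsilon> + \<bar>c2\<bar> * \<epsilon> + \<bar>c3\<bar> * \<epsilon>"
        using fg by (intro add_mono mult_left_mono) auto
      finally show ?thesis by (simp add: M_def algebra_simps)
    qed
    have le: "norm b \<le> norm v + e \<and> norm v \<le> norm b + e" if e: "e > 0" for e
    proof -
      define \<epsilon> where "\<epsilon> = e / (M + 2)"
      have M: "M \<ge> 0" by (simp add: M_def)
      then have "\<epsilon> > 0" "(M + 2) * \<epsilon> = e"
        using e by (simp_all add: \<epsilon>_def)
      then have eps: "\<epsilon> > 0" "M * \<epsilon> + 2 * \<epsilon> = e"
        by (simp_all only: distrib_right)
      have fin: "finite {b1, b2, b3, k}" "{b1, b2, b3, k} \<subseteq> B" using b k by auto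
      obtain f :: "'w \<Rightarrow> real" and g :: "'v \<Rightarrow> real" where fg: "linear f" "\<forall>y. \<bar>f y\<bar> \<le> norm y" "linear g"
        "\<forall>b\<in>{b1, b2, b3, k}. \<bar>f (E b) - g b\<bar> \<le> \<epsilon>" "norm b \<le> \<bar>g b\<bar> + \<epsilon>"
        using approx[OF fin bB eps(1)] by blast
      have "norm b \<le> norm v + e"
        using close[OF fg(1,3,4)] fg(5) spec[OF fg(2), of v] eps by linarith
      \<comment> \<open>Now the functionals norm \<open>k\<close>, a preimage of \<open>v\<close>, instead of \<open>b\<close>.\<close>
      obtain f' :: "'w \<Rightarrow> real" and g' :: "'v \<Rightarrow> real" where fg': "linear f'" "linear g'" "\<forall>b. \<bar>g' b\<bar> \<le> norm b"
        "\<forall>b\<in>{b1, b2, b3, k}. \<bar>f' (E b) - g' b\<bar> \<le> \<epsilon>" "norm k \<le> \<bar>g' k\<bar> + \<epsilon>"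
        using approx[OF fin k(1) eps(1)] by blast
      have "\<bar>f' v - g' k\<bar> \<le> \<epsilon>" using fg'(4) k(2) by auto
      moreover have "norm v = norm k" using E(1)[OF k(1)] k(2) by simp
      ultimately have "norm v \<le> norm b + e"
        using close[OF fg'(1,2,4)] fg'(5) spec[OF fg'(3), of b] eps by linarith
      then show ?thesis using \<open>norm b \<le> norm v + e\<close> by blast
    qed
    have "norm b \<le> norm v"
      using conjunct1[OF le] by (rule field_le_epsilon)
    moreover have "norm v \<le> norm b"
      using conjunct2[OF le] by (rule field_le_epsilon)
    ultimately have "norm b = norm v" by (rule antisym)
    then show ?thesis by (simp add: b_def v_def)
  qed
  have "E (x + y) = E x + E y" if "x \<in> B" "y \<in> B" for x y
    using comb[of "x + y" x y 1 "- 1" "- 1"] that subspace_add[OF B that] by (simp add: diff_eq_eq add.commute)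
  moreover have "E (c *\<^sub>R x) = c *\<^sub>R E x" if "x \<in> B" for c x
    using comb[of "c *\<^sub>R x" x x 1 "- c" 0] that subspace_scale[OF B that] by simp
  moreover have "norm (E x - E y) = norm (x - y)" if "x \<in> B" "y \<in> B" for x y
    using comb[of x y y 1 "- 1" 0] that by simp
  ultimately show ?thesis
    using E(2) by (simp add: linear_map_on_def surj_isometry_def dist_norm)
qed

context unif_alg
begin

text \<open>
  For each point \<open>x\<close> there is a contractive functional \<open>\<phi> x\<close> that is \<open>1\<close> on the image of the face
  \<open>{h. h x = 1}\<close> and \<open>- 1\<close> on the image of the opposite face. If \<open>a\<close> has distances \<open>1 - a x\<close> and
  \<open>1 + a x\<close> from the two faces, up to \<open>\<epsilon>\<close>, then so has \<open>T a\<close> from their images; comparing \<open>\<phi> x (T a)\<close>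
  with \<open>1\<close> and with \<open>- 1\<close> pins it down to \<open>a x\<close> up to \<open>\<epsilon>\<close>. So the functionals \<open>\<phi> x\<close> on the target correspond to
  evaluation on \<open>ReA\<close>, jointly for finitely many \<open>a\<close> and at points that almost norm a given function.
\<close>

lemma mazur_ulam_ReA: "mazur_ulam_property TYPE('w::banach) ReA"
  unfolding mazur_ulam_property_def
proof (intro conjI banach_over_ReA allI impI)
  fix T :: "('x \<Rightarrow>\<^sub>C real) \<Rightarrow> 'w"
  assume T: "surj_isometry (unit_sphere ReA) (unit_sphere UNIV) T"
  have T1: "norm (T a) = 1" if "a \<in> unit_sphere ReA" for a
    using T that by (auto simp: surj_isometry_def unit_sphere_def)
  have Tdist: "norm (T a - T b) = norm (a - b)" if "a \<in> unit_sphere ReA" "b \<in> unit_sphere ReA" for a b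
    using T that by (auto simp: surj_isometry_def dist_norm)
  have "\<exists>f :: 'w \<Rightarrow> real. linear f \<and> (\<forall>y. \<bar>f y\<bar> \<le> norm y) \<and>
      (\<forall>h\<in>{h \<in> unit_sphere ReA. apply_bcontfun h x = 1}. f (T h) = 1 \<and> f (T (- h)) = - 1)" for x
  proof (rule convex_face_functional[OF T])
    show "- a \<in> ReA" if "a \<in> ReA" for a
      using subspace_neg[OF subspace_ReA that] .
    show "convex {h \<in> unit_sphere ReA. apply_bcontfun h x = 1}"
    proof (rule convexI)
      fix g h and s t :: real
      assume g: "g \<in> {h \<in> unit_sphere ReA. apply_bcontfun h x = 1}" and h: "h \<in> {h \<in> unit_sphere ReA. apply_bcontfun h x = 1}"
        and st: "s \<ge> 0" "t \<ge> 0" "s + t = 1"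
      have "norm (s *\<^sub>R g + t *\<^sub>R h) \<le> 1"
        using norm_triangle_ineq[of "s *\<^sub>R g" "t *\<^sub>R h"] g h st by (simp add: unit_sphere_def)
      moreover have eq: "apply_bcontfun (s *\<^sub>R g + t *\<^sub>R h) x = 1"
        using g h st by simp
      then have "1 \<le> norm (s *\<^sub>R g + t *\<^sub>R h)"
        using norm_bounded[of "s *\<^sub>R g + t *\<^sub>R h" x] by simp
      moreover have "s *\<^sub>R g + t *\<^sub>R h \<in> ReA"
        using g h by (intro subspace_add[OF subspace_ReA] subspace_scale[OF subspace_ReA]) (auto simp: unit_sphere_def)
      ultimately show "s *\<^sub>R g + t *\<^sub>R h \<in> {h \<in> unit_sphere ReA. apply_bcontfun h x = 1}"
        using eq by (simp add: unit_sphere_def)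
    qed
  qed auto
  then obtain \<phi> :: "'x \<Rightarrow> 'w \<Rightarrow> real" where \<phi>: "\<And>x. linear (\<phi> x)" "\<And>x y. \<bar>\<phi> x y\<bar> \<le> norm y"
    "\<And>x h. h \<in> unit_sphere ReA \<Longrightarrow> apply_bcontfun h x = 1 \<Longrightarrow> \<phi> x (T h) = 1 \<and> \<phi> x (T (- h)) = - 1"
    by (simp only: mem_Collect_eq Ball_def) metis
  have val: "\<bar>\<phi> x (T a) - apply_bcontfun a x\<bar> \<le> \<epsilon>"
    if a: "a \<in> unit_sphere ReA" and u: "u \<in> ReA" "norm u \<le> 1" "apply_bcontfun u x = 1" "norm (a - u) \<le> 1 - apply_bcontfun a x + \<epsilon>"
      and v: "v \<in> ReA" "norm v \<le> 1" "apply_bcontfun v x = - 1" "norm (a - v) \<le> 1 + apply_bcontfun a x + \<epsilon>"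
    for a u v x \<epsilon>
  proof -
    have uS: "u \<in> unit_sphere ReA"
      using u norm_bounded[of u x] by (simp add: unit_sphere_def)
    have vS: "v \<in> unit_sphere ReA" "- v \<in> unit_sphere ReA"
      using v norm_bounded[of v x] subspace_neg[OF subspace_ReA v(1)] by (auto simp: unit_sphere_def)
    have "\<phi> x (T u) = 1" using \<phi>(3)[OF uS u(3)] by simp
    moreover have "\<phi> x (T v) = - 1" using \<phi>(3)[OF vS(2)] v(3) by simp
    moreover have "\<bar>\<phi> x (T a) - \<phi> x (T u)\<bar> \<le> norm (a - u)"
      using \<phi>(2)[of x "T a - T u"] Tdist[OF a uS] by (simp add: linear_diff[OF \<phi>(1)])
    moreover have "\<bar>\<phi> x (T a) - \<phi> x (T v)\<bar> \<le> norm (a - v)"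
      using \<phi>(2)[of x "T a - T v"] Tdist[OF a vS(1)] by (simp add: linear_diff[OF \<phi>(1)])
    ultimately show ?thesis using u(4) v(4) by linarith
  qed
  \<comment> \<open>The positively homogeneous extension; \<open>E 0 = 0\<close>, whatever \<open>T 0\<close> is.\<close>
  define E where "E b = norm b *\<^sub>R T (b /\<^sub>R norm b)" for b
  have unit: "b /\<^sub>R norm b \<in> unit_sphere ReA" if "b \<in> ReA" "b \<noteq> 0" for b
    using that subspace_scale[OF subspace_ReA] by (simp add: unit_sphere_def)
  have "linear_map_on scaleR scaleR ReA E \<and> surj_isometry ReA UNIV E"
  proof (rule linear_isometry_if_jointly_normed[OF subspace_ReA])
    show "norm (E b) = norm b" if "b \<in> ReA" for b
      using T1[OF unit[OF that]] by (cases "b = 0") (simp_all add: E_def)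
    show "E ` ReA = UNIV"
    proof (rule UNIV_eq_I[symmetric])
      fix y :: 'w
      show "y \<in> E ` ReA"
      proof (cases "y = 0")
        case True
        then show ?thesis
          using subspace_0[OF subspace_ReA] by (intro image_eqI[of _ _ 0]) (auto simp: E_def)
      next
        case False
        then have "y /\<^sub>R norm y \<in> T ` unit_sphere ReA"
          using T by (simp add: surj_isometry_def unit_sphere_def)
        then obtain a where a: "a \<in> unit_sphere ReA" "T a = y /\<^sub>R norm y" by auto
        have "E (norm y *\<^sub>R a) = y"
          using a False by (simp add: E_def unit_sphere_def)
        then show ?thesis
          using a(1) subspace_scale[OF subspace_ReA] by (intro image_eqI[of _ _ "norm y *\<^sub>R a"]) (auto simp: unit_sphere_def)
      qed
    qed
    fix S k and \<epsilon> :: real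
    assume S: "finite S" "S \<subseteq> ReA" and k: "k \<in> ReA" and eps: "\<epsilon> > 0"
    define M where "M = (\<Sum>b\<in>S. norm b)"
    have M: "norm b \<le> M" if "b \<in> S" for b
      unfolding M_def using S(1) that by (intro member_le_sum) auto
    have M0: "M \<ge> 0" by (simp add: M_def sum_nonneg)
    define \<delta> where "\<delta> = \<epsilon> / (M + 1)"
    have \<delta>: "\<delta> > 0" "M * \<delta> \<le> \<epsilon>" "\<delta> \<le> \<epsilon>"
      using eps M0 by (auto simp: \<delta>_def field_simps)
    obtain x0 where x0: "\<bar>apply_bcontfun k x0\<bar> = norm k"
      using bcontfun_attains_norm[OF compact_UNIV, of k] by auto
    define \<sigma> where "\<sigma> = (if apply_bcontfun k x0 \<ge> 0 then 1 else - 1 :: real)"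
    define S' where "S' = (\<lambda>b. b /\<^sub>R norm b) ` (S - {0})"
    have S': "finite S'" "a \<in> S' \<Longrightarrow> a \<in> ReA \<and> norm a \<le> 1" "a \<in> S' \<Longrightarrow> a \<in> unit_sphere ReA" for a
      using S unit by (auto simp: S'_def unit_sphere_def)
    obtain x where x: "\<And>a. a \<in> S' \<Longrightarrow> \<exists>u\<in>ReA. \<exists>v\<in>ReA. norm u \<le> 1 \<and> norm v \<le> 1 \<and>
      apply_bcontfun u x = 1 \<and> apply_bcontfun v x = - 1 \<and>
      norm (a - u) \<le> 1 - apply_bcontfun a x + \<delta> \<and> norm (a - v) \<le> 1 + apply_bcontfun a x + \<delta>"
      and kx: "\<And>y. apply_bcontfun (\<sigma> *\<^sub>R k) y \<le> apply_bcontfun (\<sigma> *\<^sub>R k) x + \<delta>"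
      using ReA_near_faces[OF S'(1,2) subspace_scale[OF subspace_ReA k] \<delta>(1), of \<sigma>] by blast
    have "\<bar>\<phi> x (E b) - apply_bcontfun b x\<bar> \<le> \<epsilon>" if b: "b \<in> S" for b
    proof (cases "b = 0")
      case True
      then show ?thesis using eps by (simp add: E_def linear_0[OF \<phi>(1)])
    next
      case False
      define a where "a = b /\<^sub>R norm b"
      have a: "a \<in> S'" using b False by (auto simp: a_def S'_def)
      then have "\<bar>\<phi> x (T a) - apply_bcontfun a x\<bar> \<le> \<delta>"
        using x[OF a] val[OF S'(3)[OF a]] by blast
      then have "norm b * \<bar>\<phi> x (T a) - apply_bcontfun a x\<bar> \<le> M * \<delta>"
        using M[OF b] M0 by (intro mult_mono) auto
      moreover have "\<phi> x (E b) - apply_bcontfun b x = norm b * (\<phi> x (T a) - apply_bcontfun a x)"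
        using False by (simp add: E_def linear_cmul[OF \<phi>(1)] a_def algebra_simps)
      ultimately show ?thesis using \<delta>(2) by (simp add: abs_mult)
    qed
    moreover have "norm k \<le> \<bar>apply_bcontfun k x\<bar> + \<epsilon>"
      using kx[of x0] x0 \<delta>(3) by (auto simp: \<sigma>_def split: if_splits)
    moreover have "linear (\<lambda>b :: 'x \<Rightarrow>\<^sub>C real. apply_bcontfun b x)"
      by (rule linearI) simp_all
    moreover have "\<bar>apply_bcontfun b x\<bar> \<le> norm b" for b :: "'x \<Rightarrow>\<^sub>C real"
      using norm_bounded[of b x] by simp
    ultimately show "\<exists>(f :: 'w \<Rightarrow> real) g. linear f \<and> (\<forall>y. \<bar>f y\<bar> \<le> norm y) \<and> linear g \<and> (\<forall>b. \<bar>g b\<bar> \<le> norm b) \<and>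
        (\<forall>b\<in>S. \<bar>f (E b) - g b\<bar> \<le> \<epsilon>) \<and> norm k \<le> \<bar>g k\<bar> + \<epsilon>"
      using \<phi>(1,2) by (intro exI[of _ "\<phi> x"] exI[of _ "\<lambda>b. apply_bcontfun b x"]) auto
  qed
  moreover have "E a = T a" if "a \<in> unit_sphere ReA" for a
    using that by (simp add: E_def unit_sphere_def)
  ultimately show "\<exists>g. linear_map_on scaleR scaleR ReA g \<and> surj_isometry ReA UNIV g \<and> (\<forall>a\<in>unit_sphere ReA. g a = T a)"
    by blast
qed

end

theorem corollary2p5:
  fixes A :: "('x::t2_space \<Rightarrow>\<^sub>C complex) set"
  assumes "uniform_algebra A"
  shows "lush scaleC_bcontfun A
    \<and> lush scaleR (closure (Re_bcontfun ` A))
    \<and> mazur_ulam_property TYPE('w::banach) (closure (Re_bcontfun ` A))"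
proof -
  interpret unif_alg A by (rule unif_alg.intro) fact
  show ?thesis
    using lush_A lush_ReA mazur_ulam_ReA unfolding ReA_def by blast
qed

end
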